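(* Let $V$ be an $n$-dimensional vector space over $\mathbb{F}_q$ with $n>1$, and let $\mathcal{F}\subseteq\mathcal{L}(V)$ be an antichain. Then: (i) $|\mathcal{F}|\leq \left[n\atop \lfloor n/2\rfloor\right]$, with equality if and only if $\mathcal{F}=\left[V\atop \lfloor n/2\rfloor\right]$ or $\mathcal{F}=\left[V\atop \lceil n/2\rceil\right]$. (ii) If $\mathcal{F}\nsubseteq\left[V\atop \lfloor n/2\rfloor\right]$ and $\mathcal{F}\nsubseteq\left[V\atop \lceil n/2\rceil\right]$, then $$|\mathcal{F}|\leq \left[n\atop \lfloor n/2\rfloor\right]-q\left[\lfloor n/2\rfloor\atop 1\right],$$ with equality if and only if $\mathcal{F}=\mathcal{A}[n,n]$ or $\mathcal{F}=\mathcal{B}[n,n]$.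
   Context: $\left[m\atop k\right]=\prod_{0\leq i<k}\frac{q^{m-i}-1}{q^{k-i}-1}$ is the Gaussian binomial coefficient; $\left[V\atop k\right]$ is the set of $k$-dimensional subspaces of $V$ and $\mathcal{L}(V)$ the set of all subspaces. A family $\mathcal{F}\subseteq\mathcal{L}(V)$ is an antichain if $F\nleq F'$ for any two distinct $F,F'\in\mathcal{F}$. For $2\leq s\leq n$: $\mathcal{A}[n,s]=(\left[V\atop \lceil s/2\rceil\right]\setminus\{F\in\left[V\atop \lceil s/2\rceil\right]:U\leq F\})\cup\{U\}$ where $U$ is a fixed $(\lceil s/2\rceil-1)$-dimensional subspace of $V$; $\mathcal{B}[n,s]=(\left[V\atop \lfloor s/2\rfloor\right]\setminus\{F\in\left[V\atop \lfloor s/2\rfloor\right]:F\leq W\})\cup\{W\}$ where $W$ is a fixed $(\lfloor s/2\rfloor+1)$-dimensional subspace of $V$. *)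

theory Defs
  imports Complex_Main "HOL-Library.Cardinality"
begin

text \<open>For \<open>m < k\<close> the truncated exponents are harmless: the factor with \<open>i = m\<close> vanishes.\<close>
definition gauss_binomial :: "nat \<Rightarrow> nat \<Rightarrow> nat \<Rightarrow> real" where
  "gauss_binomial q m k = (\<Prod>i<k. (real q ^ (m - i) - 1) / (real q ^ (k - i) - 1))"

definition antichain :: "'b set set \<Rightarrow> bool" where
  "antichain \<F> \<longleftrightarrow> (\<forall>F\<in>\<F>. \<forall>F'\<in>\<F>. F \<noteq> F' \<longrightarrow> \<not> F \<subseteq> F')"

context vector_space
begin

text \<open>The vector space \<open>V\<close> is the whole type \<^typ>\<open>'b\<close>.  Below, \<open>(s + 1) div 2\<close> is the
  ceiling and \<open>s div 2\<close> the floor of \<open>s/2\<close>.  Without \<open>local\<close>, the names can resolve to the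
  global interpretation for real vector spaces.\<close>

definition subspaces :: "'b set set" where
  "subspaces = {F. local.subspace F}"

definition k_subspaces :: "nat \<Rightarrow> 'b set set" where
  "k_subspaces k = {F. local.subspace F \<and> local.dim F = k}"

text \<open>The fixed subspaces \<open>U\<close> and \<open>W\<close> are parameters; they are meant to have dimension
  \<open>(s + 1) div 2 - 1\<close> and \<open>s div 2 + 1\<close> respectively.\<close>

definition family_A :: "nat \<Rightarrow> 'b set \<Rightarrow> 'b set set" where
  "family_A s U =
     (local.k_subspaces ((s + 1) div 2) - {F \<in> local.k_subspaces ((s + 1) div 2). U \<subseteq> F}) \<union> {U}"

definition family_B :: "nat \<Rightarrow> 'b set \<Rightarrow> 'b set set" where
  "family_B s W =
     (local.k_subspaces (s div 2) - {F \<in> local.k_subspaces (s div 2). F \<subseteq> W}) \<union> {W}"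

end

end

theory Submission
  imports Defs "HOL-Analysis.Convex"
begin

text \<open>
  Write \<open>[k] = 1 + q + \<dots> + q\<^bsup>k-1\<^esup>\<close> and \<open>m = \<lfloor>n/2\<rfloor>\<close>. Replacing the lowest level of an antichain by
  its upper shadow keeps it an antichain and strictly enlarges it below the middle; dually from
  above. If some member lies below level \<open>m\<close>, all such members can be pushed to level \<open>m - 1\<close>, and
  the last push gains at least \<open>q [m]\<close>, because two subspaces of equal dimension have at most one
  common upper cover.

  For \<open>n = 2 m + 1\<close> an antichain may also meet both levels \<open>m\<close> and \<open>m + 1\<close> and no others, where
  pushing gains nothing by degree counting. By duality its part \<open>A\<close> in level \<open>m\<close> may be assumed to be
  at most half of the level. A small \<open>A\<close> is treated as before. For large \<open>A\<close> the up and down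
  operators satisfy \<open>D U - U D = [n - k] - [k]\<close> on level \<open>k\<close>, which bounds the norm of \<open>U\<close> on
  sum-zero functions, and the Cauchy--Schwarz inequality then makes the shadow of \<open>A\<close> large.
\<close>

section \<open>q-integers and an arithmetic bound\<close>

definition q_int :: "nat \<Rightarrow> nat \<Rightarrow> nat" where
  "q_int q k = (\<Sum>i<k. q ^ i)"

lemma q_int_0 [simp]: "q_int q 0 = 0"
  by (simp add: q_int_def)

lemma q_int_Suc: "q_int q (Suc k) = Suc (q * q_int q k)"
  unfolding q_int_def by (subst sum.lessThan_Suc_shift) (simp add: sum_distrib_left)

lemma q_int_Suc': "q_int q (Suc k) = q_int q k + q ^ k"
  by (simp add: q_int_def)

lemma q_int_mono: "j \<le> k \<Longrightarrow> q_int q j \<le> q_int q k"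
  unfolding q_int_def by (rule sum_mono2) auto

lemma q_int_strict_mono:
  assumes "q > 0" "j < k"
  shows "q_int q j < q_int q k"
proof -
  have "q_int q j < q_int q (Suc j)"
    using assms by (simp add: q_int_Suc')
  also have "\<dots> \<le> q_int q k"
    using assms by (intro q_int_mono) auto
  finally show ?thesis .
qed

text \<open>A geometric sum stays below its next term. This decides the case of large sets in
  \<open>up_shadow_gain_below_middle\<close>.\<close>

lemma q_int_less_power:
  assumes "q \<ge> 2"
  shows "q_int q k < q ^ k"
proof (induction k)
  case (Suc k)
  then have "q_int q (Suc k) < 2 * q ^ k"
    by (simp add: q_int_Suc')
  also have "\<dots> \<le> q ^ Suc k"
    using assms by simp
  finally show ?case .
qed simp

text \<open>The arithmetic of the case of few elements: \<open>a\<close> and \<open>s\<close> stand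
  for the sizes of a set and of its shadow, \<open>D\<close> for the up-degree, and
  \<open>pairs\<close> comes from \<open>up_shadow_pairs\<close>. With b = a - 1, twice the surplus
  s - a - e is at least b (2e - b - 1). This is nonnegative because a \<le> e + 1 < 2e, and positive
  once b > 0.\<close>

lemma pair_bound_gain:
  fixes a s D e :: nat
  assumes pairs: "2 * a * D \<le> 2 * s + a * (a - 1)" and D: "Suc e \<le> D" and a: "a > 0" "a \<le> Suc e"
    and e: "e \<ge> 2"
  shows "a + e \<le> s" "a > 1 \<Longrightarrow> a + e < s"
proof -
  obtain b where b: "a = Suc b"
    using a(1) by (cases a) auto
  have "2 * a * Suc e \<le> 2 * a * D"
    using D by (rule mult_le_mono2)
  with pairs have "2 * Suc b * Suc e \<le> 2 * s + Suc b * b"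
    unfolding b by simp
  moreover define t u where "t = b * Suc b" and "u = b * (2 * e)"
  ultimately have *: "2 * (a + e) + u \<le> 2 * s + t"
    unfolding b t_def u_def by (simp add: algebra_simps)
  have less: "Suc b < 2 * e"
    using a(2) e b by simp
  then have "t \<le> u"
    unfolding t_def u_def by (intro mult_le_mono2) simp
  with * show "a + e \<le> s"
    by simp
  assume "a > 1"
  with less have "t < u"
    unfolding t_def u_def by (intro mult_less_mono2) (auto simp: b)
  with * show "a + e < s"
    by simp
qed

subsection \<open>Regular ranked posets\<close>

text \<open>The axioms are invariant under reversing the order, so every one-sided statement about
  upper shadows also yields its dual.\<close>

locale q_regular_poset =
  fixes P :: "'p set" and le :: "'p \<Rightarrow> 'p \<Rightarrow> bool" (infix "\<sqsubseteq>" 50)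
    and rk :: "'p \<Rightarrow> nat" and n q :: nat
  assumes q_ge_2: "2 \<le> q"
    and finite_P: "finite P"
    and rk_le: "x \<in> P \<Longrightarrow> rk x \<le> n"
    and le_trans: "\<lbrakk>x \<in> P; y \<in> P; z \<in> P; x \<sqsubseteq> y; y \<sqsubseteq> z\<rbrakk> \<Longrightarrow> x \<sqsubseteq> z"
    and rk_mono: "\<lbrakk>x \<in> P; y \<in> P; x \<sqsubseteq> y\<rbrakk> \<Longrightarrow> rk x \<le> rk y"
    and le_rk_eq: "\<lbrakk>x \<in> P; y \<in> P; x \<sqsubseteq> y; rk x = rk y\<rbrakk> \<Longrightarrow> x = y"
    and card_upper: "x \<in> P \<Longrightarrow> card {y \<in> P. rk y = Suc (rk x) \<and> x \<sqsubseteq> y} = q_int q (n - rk x)"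
    and card_lower: "x \<in> P \<Longrightarrow> card {y \<in> P. Suc (rk y) = rk x \<and> y \<sqsubseteq> x} = q_int q (rk x)"
    and common_covers: "\<lbrakk>x \<in> P; x' \<in> P; x \<noteq> x'; rk x = rk x'\<rbrakk> \<Longrightarrow>
      card {y \<in> P. rk y = Suc (rk x) \<and> x \<sqsubseteq> y \<and> x' \<sqsubseteq> y}
        = card {y \<in> P. Suc (rk y) = rk x \<and> y \<sqsubseteq> x \<and> y \<sqsubseteq> x'}"
    and common_upper_le_1: "\<lbrakk>x \<in> P; x' \<in> P; x \<noteq> x'; rk x = rk x'\<rbrakk> \<Longrightarrow>
      card {y \<in> P. rk y = Suc (rk x) \<and> x \<sqsubseteq> y \<and> x' \<sqsubseteq> y} \<le> 1"
    and card_bottom: "card {x \<in> P. rk x = 0} = 1"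
    and card_top: "card {x \<in> P. rk x = n} = 1"
begin

definition level :: "nat \<Rightarrow> 'p set" where
  "level k = {x \<in> P. rk x = k}"

definition upper :: "'p \<Rightarrow> 'p set" where
  "upper x = {y \<in> P. rk y = Suc (rk x) \<and> x \<sqsubseteq> y}"

definition lower :: "'p \<Rightarrow> 'p set" where
  "lower x = {y \<in> P. Suc (rk y) = rk x \<and> y \<sqsubseteq> x}"

definition up_shadow :: "'p set \<Rightarrow> 'p set" where
  "up_shadow A = (\<Union>x\<in>A. upper x)"

definition incomparable :: "'p set \<Rightarrow> bool" where
  "incomparable F \<longleftrightarrow> F \<subseteq> P \<and> (\<forall>x\<in>F. \<forall>y\<in>F. x \<noteq> y \<longrightarrow> \<not> x \<sqsubseteq> y)"

text \<open>Reversal swaps \<open>card_upper\<close> with \<open>card_lower\<close> and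
  \<open>card_bottom\<close> with \<open>card_top\<close>. That two elements have at most one common
  lower cover is not an axiom; it follows from \<open>common_upper_le_1\<close> through
  \<open>common_covers\<close>. Truncation in \<open>n - rk x\<close> is excluded by
  \<open>rk_le\<close>.\<close>

lemma dual: "q_regular_poset P (\<lambda>x y. y \<sqsubseteq> x) (\<lambda>x. n - rk x) n q"
proof
  show "2 \<le> q" "finite P" by (fact q_ge_2 finite_P)+
  show "card {x \<in> P. n - rk x = 0} = 1"
    by (rule trans[OF _ card_top], rule arg_cong[where f = card]) (use rk_le in force)
  show "card {x \<in> P. n - rk x = n} = 1"
    by (rule trans[OF _ card_bottom], rule arg_cong[where f = card]) (use rk_le in force)
next
  fix x y assume "x \<in> P" "y \<in> P" "y \<sqsubseteq> x" "n - rk x = n - rk y"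
  then show "x = y"
    using le_rk_eq[of y x] rk_le[of x] rk_le[of y] by fastforce
next
  fix x assume x: "x \<in> P"
  have "{y \<in> P. n - rk y = Suc (n - rk x) \<and> y \<sqsubseteq> x} = {y \<in> P. Suc (rk y) = rk x \<and> y \<sqsubseteq> x}"
    using rk_le x by force
  then show "card {y \<in> P. n - rk y = Suc (n - rk x) \<and> y \<sqsubseteq> x} = q_int q (n - (n - rk x))"
    using card_lower[OF x] rk_le[OF x] by simp
  have "{y \<in> P. Suc (n - rk y) = n - rk x \<and> x \<sqsubseteq> y} = {y \<in> P. rk y = Suc (rk x) \<and> x \<sqsubseteq> y}"
    using rk_le x by force
  then show "card {y \<in> P. Suc (n - rk y) = n - rk x \<and> x \<sqsubseteq> y} = q_int q (n - rk x)"
    using card_upper[OF x] by simp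
next
  fix x x' assume x: "x \<in> P" "x' \<in> P" "x \<noteq> x'" "n - rk x = n - rk x'"
  then have rk: "rk x = rk x'"
    using rk_le[of x] rk_le[of x'] by linarith
  have 1: "{y \<in> P. n - rk y = Suc (n - rk x) \<and> y \<sqsubseteq> x \<and> y \<sqsubseteq> x'}
        = {y \<in> P. Suc (rk y) = rk x \<and> y \<sqsubseteq> x \<and> y \<sqsubseteq> x'}"
    using rk_le x by force
  have 2: "{y \<in> P. Suc (n - rk y) = n - rk x \<and> x \<sqsubseteq> y \<and> x' \<sqsubseteq> y}
        = {y \<in> P. rk y = Suc (rk x) \<and> x \<sqsubseteq> y \<and> x' \<sqsubseteq> y}"
    using rk_le x by force
  show "card {y \<in> P. n - rk y = Suc (n - rk x) \<and> y \<sqsubseteq> x \<and> y \<sqsubseteq> x'}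
        = card {y \<in> P. Suc (n - rk y) = n - rk x \<and> x \<sqsubseteq> y \<and> x' \<sqsubseteq> y}"
    "card {y \<in> P. n - rk y = Suc (n - rk x) \<and> y \<sqsubseteq> x \<and> y \<sqsubseteq> x'} \<le> 1"
    unfolding 1 2 using common_covers[OF x(1-3) rk] common_upper_le_1[OF x(1-3) rk] by auto
next
  fix x y z assume "x \<in> P" "y \<in> P" "z \<in> P" "y \<sqsubseteq> x" "z \<sqsubseteq> y"
  then show "z \<sqsubseteq> x"
    using le_trans[of z y x] by simp
next
  fix x y assume "x \<in> P" "y \<in> P" "y \<sqsubseteq> x"
  then show "n - rk x \<le> n - rk y"
    using rk_mono[of y x] by simp
qed simp

lemma finite_subset_P: "A \<subseteq> P \<Longrightarrow> finite A"
  using finite_P finite_subset by blast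

lemma finite_simps [simp]:
  "finite (level k)" "finite (upper x)" "finite (lower x)"
  by (auto simp: level_def upper_def lower_def finite_P)

lemma upper_level: "x \<in> level k \<Longrightarrow> upper x = {y. y \<in> level (Suc k) \<and> x \<sqsubseteq> y}"
  by (auto simp: upper_def level_def)

lemma lower_level: "y \<in> level (Suc k) \<Longrightarrow> lower y = {x. x \<in> level k \<and> x \<sqsubseteq> y}"
  by (auto simp: lower_def level_def)

lemma card_upper_level: "x \<in> level k \<Longrightarrow> card (upper x) = q_int q (n - k)"
  using card_upper[of x] by (auto simp: upper_def level_def)

lemma card_lower_level: "x \<in> level k \<Longrightarrow> card (lower x) = q_int q k"
  using card_lower[of x] by (auto simp: lower_def level_def)

lemma up_shadow_level: "A \<subseteq> level k \<Longrightarrow> up_shadow A \<subseteq> level (Suc k)"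
  by (auto simp: up_shadow_def level_def upper_def)

lemma finite_up_shadow: "A \<subseteq> P \<Longrightarrow> finite (up_shadow A)"
  by (auto simp: up_shadow_def finite_subset_P)

section \<open>Up and down operators between consecutive levels\<close>

lemma up_down_adjoint:
  "(\<Sum>x\<in>level k. f x * (\<Sum>y\<in>upper x. g y)) = (\<Sum>y\<in>level (Suc k). g y * (\<Sum>x\<in>lower y. f x))"
  for f g :: "'p \<Rightarrow> real"
proof -
  have "(\<Sum>x\<in>level k. f x * (\<Sum>y\<in>upper x. g y))
      = (\<Sum>x\<in>level k. \<Sum>y\<in>{y. y \<in> level (Suc k) \<and> x \<sqsubseteq> y}. f x * g y)"
    by (simp add: sum_distrib_left upper_level)
  \<comment> \<open>Both sides are the sum of f x g y over all cover pairs between the two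
    levels.\<close>
  also have "\<dots> = (\<Sum>y\<in>level (Suc k). \<Sum>x\<in>{x. x \<in> level k \<and> x \<sqsubseteq> y}. f x * g y)"
    by (rule sum.swap_restrict) auto
  also have "\<dots> = (\<Sum>y\<in>level (Suc k). g y * (\<Sum>x\<in>lower y. f x))"
    by (simp add: sum_distrib_left lower_level mult.commute)
  finally show ?thesis .
qed

text \<open>The matrix of going up and then down: its entry at x and x' counts their common upper
  covers. \<open>sum_lower_upper\<close> is the counterpart for going down first.\<close>

lemma sum_upper_lower:
  fixes f :: "'p \<Rightarrow> real"
  assumes x: "x \<in> level k"
  shows "(\<Sum>y\<in>upper x. \<Sum>x'\<in>lower y. f x')
    = (\<Sum>x'\<in>level k. f x' * card {y. y \<in> upper x \<and> x' \<sqsubseteq> y})"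
proof -
  have "(\<Sum>y\<in>upper x. \<Sum>x'\<in>lower y. f x') = (\<Sum>y\<in>upper x. \<Sum>x'\<in>{x'. x' \<in> level k \<and> x' \<sqsubseteq> y}. f x')"
    using x by (intro sum.cong) (auto simp: upper_level lower_level)
  also have "\<dots> = (\<Sum>x'\<in>level k. \<Sum>y\<in>{y. y \<in> upper x \<and> x' \<sqsubseteq> y}. f x')"
    by (rule sum.swap_restrict) auto
  also have "\<dots> = (\<Sum>x'\<in>level k. f x' * card {y. y \<in> upper x \<and> x' \<sqsubseteq> y})"
    by (simp add: mult.commute)
  finally show ?thesis .
qed

lemma sum_lower_upper:
  fixes f :: "'p \<Rightarrow> real"
  assumes x: "x \<in> level k"
  shows "(\<Sum>z\<in>lower x. \<Sum>x'\<in>upper z. f x')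
    = (\<Sum>x'\<in>level k. f x' * card {z. z \<in> lower x \<and> z \<sqsubseteq> x'})"
proof -
  have "(\<Sum>z\<in>lower x. \<Sum>x'\<in>upper z. f x') = (\<Sum>z\<in>lower x. \<Sum>x'\<in>{x'. x' \<in> level k \<and> z \<sqsubseteq> x'}. f x')"
    using x by (intro sum.cong) (auto simp: upper_def lower_def level_def)
  also have "\<dots> = (\<Sum>x'\<in>level k. \<Sum>z\<in>{z. z \<in> lower x \<and> z \<sqsubseteq> x'}. f x')"
    by (rule sum.swap_restrict) auto
  also have "\<dots> = (\<Sum>x'\<in>level k. f x' * card {z. z \<in> lower x \<and> z \<sqsubseteq> x'})"
    by (simp add: mult.commute)
  finally show ?thesis .
qed

text \<open>By \<open>common_covers\<close> the two matrices agree off the diagonal; on the diagonal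
  they carry the up-degree and the down-degree.\<close>

lemma up_down_commutator:
  fixes f :: "'p \<Rightarrow> real"
  assumes x: "x \<in> level k"
  shows "(\<Sum>y\<in>upper x. \<Sum>x'\<in>lower y. f x')
    = (\<Sum>z\<in>lower x. \<Sum>x'\<in>upper z. f x') + (real (q_int q (n - k)) - real (q_int q k)) * f x"
proof -
  define u where "u x' = real (card {y. y \<in> upper x \<and> x' \<sqsubseteq> y})" for x'
  define l where "l x' = real (card {z. z \<in> lower x \<and> z \<sqsubseteq> x'})" for x'
  have "u x' = l x'" if "x' \<in> level k - {x}" for x'
    using common_covers[of x x'] x that
    by (auto simp: u_def l_def upper_def lower_def level_def)
  then have "(\<Sum>x'\<in>level k - {x}. f x' * u x') = (\<Sum>x'\<in>level k - {x}. f x' * l x')"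
    by (intro sum.cong) auto
  moreover have "{y. y \<in> upper x \<and> x \<sqsubseteq> y} = upper x" "{z. z \<in> lower x \<and> z \<sqsubseteq> x} = lower x"
    by (auto simp: upper_def lower_def)
  then have "u x = q_int q (n - k)" "l x = q_int q k"
    using x by (auto simp: u_def l_def card_upper_level card_lower_level)
  ultimately show ?thesis
    unfolding sum_upper_lower[OF x] sum_lower_upper[OF x] u_def[symmetric] l_def[symmetric]
      sum.remove[OF finite_simps(1) x]
    by (simp add: algebra_simps)
qed

text \<open>The commutation relation turns a bound for level \<open>k\<close> into one for level \<open>Suc k\<close>, because
  the down operator is adjoint to the up operator and preserves sum-zero functions; the increments
  \<open>[n - k] - [k]\<close> add up to \<open>q [k] [n - k - 1]\<close>.\<close>

lemma up_operator_norm: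
  fixes f :: "'p \<Rightarrow> real"
  assumes "k < n" "(\<Sum>x\<in>level k. f x) = 0"
  shows "(\<Sum>y\<in>level (Suc k). (\<Sum>x\<in>lower y. f x)\<^sup>2)
    \<le> real (q * q_int q k * q_int q (n - k - 1)) * (\<Sum>x\<in>level k. (f x)\<^sup>2)"
  using assms
proof (induction k arbitrary: f)
  case 0
  \<comment> \<open>Level 0 is a single element, so a sum-zero function vanishes on it.\<close>
  obtain b where b: "level 0 = {b}"
    using card_bottom by (auto simp: level_def card_1_singleton_iff)
  have "f x = 0" if "x \<in> level 0" for x
    using 0 b that by simp
  then have "(\<Sum>x\<in>lower y. f x) = 0" if "y \<in> level (Suc 0)" for y
    using that by (intro sum.neutral) (simp add: lower_level)
  then show ?case by simp
next
  case (Suc k)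
  define g where "g z = (\<Sum>x\<in>upper z. f x)" for z
  define Sf where "Sf = (\<Sum>x\<in>level (Suc k). (f x)\<^sup>2)"
  define Sg where "Sg = (\<Sum>z\<in>level k. (g z)\<^sup>2)"
  define lam where "lam = real (q * q_int q k * q_int q (n - k - 1))"
  have Sf0: "Sf \<ge> 0" and Sg0: "Sg \<ge> 0" and lam0: "lam \<ge> 0"
    by (auto simp: Sf_def Sg_def lam_def intro: sum_nonneg)
  have "(\<Sum>z\<in>level k. g z) = (\<Sum>x\<in>level (Suc k). f x * q_int q (Suc k))"
    using up_down_adjoint[of "\<lambda>_. 1" f k] by (simp add: g_def card_lower_level)
  also have "\<dots> = 0"
    using Suc.prems by (simp flip: sum_distrib_right)
  finally have IH: "(\<Sum>x\<in>level (Suc k). (\<Sum>z\<in>lower x. g z)\<^sup>2) \<le> lam * Sg"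
    using Suc.IH[of g] Suc.prems by (simp add: lam_def Sg_def)
  \<comment> \<open>The down operator inherits the bound of its adjoint: pairing f with the up-image
    of g gives \<open>Sg\<close>, and Cauchy-Schwarz with the induction hypothesis yields
    \<open>Sg\<close> \<le> \<open>lam\<close> \<open>Sf\<close>.\<close>
  have "Sg = (\<Sum>x\<in>level (Suc k). f x * (\<Sum>z\<in>lower x. g z))"
    using up_down_adjoint[of g f k] by (simp add: Sg_def g_def power2_eq_square)
  then have "Sg\<^sup>2 \<le> Sf * (\<Sum>x\<in>level (Suc k). (\<Sum>z\<in>lower x. g z)\<^sup>2)"
    by (simp add: Sf_def Cauchy_Schwarz_ineq_sum)
  also have "\<dots> \<le> Sf * (lam * Sg)"
    using IH Sf0 by (rule mult_left_mono)
  finally have "Sg * Sg \<le> (lam * Sf) * Sg"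
    by (simp add: power2_eq_square mult_ac)
  then have Sg_le: "Sg \<le> lam * Sf"
    using Sf0 Sg0 lam0 by (cases "Sg = 0") auto
  \<comment> \<open>The squared norm of the up-image is the pairing of f with its down-after-up
    image, to which the commutation relation applies.\<close>
  have "(\<Sum>y\<in>level (Suc (Suc k)). (\<Sum>x\<in>lower y. f x)\<^sup>2)
      = (\<Sum>x\<in>level (Suc k). f x * (\<Sum>y\<in>upper x. \<Sum>x'\<in>lower y. f x'))"
    using up_down_adjoint[of f "\<lambda>y. \<Sum>x\<in>lower y. f x" "Suc k"] by (simp add: power2_eq_square)
  also have "\<dots> = (\<Sum>x\<in>level (Suc k). f x * (\<Sum>z\<in>lower x. g z)
      + (real (q_int q (n - Suc k)) - real (q_int q (Suc k))) * (f x)\<^sup>2)"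
    by (intro sum.cong)
      (auto simp: up_down_commutator g_def power2_eq_square algebra_simps)
  also have "\<dots> = Sg + (real (q_int q (n - Suc k)) - real (q_int q (Suc k))) * Sf"
    using \<open>Sg = (\<Sum>x\<in>level (Suc k). f x * (\<Sum>z\<in>lower x. g z))\<close>
    by (simp add: sum.distrib Sf_def sum_distrib_left)
  also have "\<dots> \<le> (lam + (real (q_int q (n - Suc k)) - real (q_int q (Suc k)))) * Sf"
    using Sg_le by (simp add: algebra_simps)
  also have "lam + (real (q_int q (n - Suc k)) - real (q_int q (Suc k)))
      = real (q * q_int q (Suc k) * q_int q (n - Suc k - 1))"
  proof -
    \<comment> \<open>Writing n as k + j + 2 removes all truncated subtractions; what remains is a
      polynomial identity in [k] and [j].\<close>
    obtain j where "n = Suc (Suc (k + j))"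
      using Suc.prems(1) by (metis add_Suc less_iff_Suc_add)
    then show ?thesis
      by (simp add: lam_def q_int_Suc algebra_simps)
  qed
  finally show ?case
    unfolding Sf_def .
qed

subsection \<open>Shadows\<close>

lemma card_level_Suc:
  "card (level k) * q_int q (n - k) = card (level (Suc k)) * q_int q (Suc k)"
proof -
  have "real (card (level k) * q_int q (n - k)) = real (card (level (Suc k)) * q_int q (Suc k))"
    using up_down_adjoint[of "\<lambda>_. 1" "\<lambda>_. 1" k] by (simp add: card_upper_level card_lower_level)
  then show ?thesis
    by linarith
qed

lemma finite_level_subset: "A \<subseteq> level k \<Longrightarrow> finite A"
  by (rule finite_subset[OF _ finite_simps(1)])

lemma degree_outside_up_shadow:
  assumes "A \<subseteq> level k" "y \<in> level (Suc k) - up_shadow A"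
  shows "lower y \<inter> A = {}"
  using assms by (auto simp: up_shadow_def upper_def lower_def level_def)

lemma sum_degree_up_shadow:
  assumes "A \<subseteq> level k"
  shows "(\<Sum>y\<in>up_shadow A. card (lower y \<inter> A)) = card A * q_int q (n - k)"
proof -
  have "(\<Sum>x\<in>level k. if x \<in> A then real (q_int q (n - k)) else 0)
      = (\<Sum>x\<in>level k. (if x \<in> A then 1 else 0) * (\<Sum>y\<in>upper x. 1))"
    by (intro sum.cong) (auto simp: card_upper_level)
  also have "\<dots> = (\<Sum>y\<in>level (Suc k). \<Sum>x\<in>lower y. if x \<in> A then 1 else 0)"
    using up_down_adjoint[of "\<lambda>x. if x \<in> A then 1 else 0" "\<lambda>_. 1" k] by simp
  also have "\<dots> = (\<Sum>y\<in>level (Suc k). real (card (lower y \<inter> A)))"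
    by (simp flip: sum.inter_restrict)
  also have "\<dots> = (\<Sum>y\<in>up_shadow A. real (card (lower y \<inter> A)))"
  proof (rule sum.mono_neutral_right)
    show "\<forall>y\<in>level (Suc k) - up_shadow A. real (card (lower y \<inter> A)) = 0"
      using degree_outside_up_shadow[OF assms] by simp
  qed (use up_shadow_level[OF assms] in auto)
  finally have "real (card A * q_int q (n - k)) = real (\<Sum>y\<in>up_shadow A. card (lower y \<inter> A))"
    using assms by (simp flip: sum.inter_restrict add: inf.absorb2)
  then show ?thesis
    by linarith
qed

text \<open>The local LYM inequality: an element of the shadow has only [k+1] lower covers, hence at
  most that many in A.\<close>

lemma up_shadow_ratio:
  assumes "A \<subseteq> level k"
  shows "card A * q_int q (n - k) \<le> card (up_shadow A) * q_int q (Suc k)"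
proof -
  have "card A * q_int q (n - k) \<le> (\<Sum>y\<in>up_shadow A. q_int q (Suc k))"
    unfolding sum_degree_up_shadow[OF assms, symmetric]
    using up_shadow_level[OF assms]
    by (intro sum_mono) (metis card_lower_level card_mono finite_simps(3) inf_le1 subsetD)
  then show ?thesis by simp
qed

text \<open>The Bonferroni inequality for the sets of upper covers, which pairwise meet in at most
  one element. Doubling and moving the pair count to the right keeps it free of division and
  subtraction.\<close>

lemma up_shadow_pairs:
  assumes "A \<subseteq> level k"
  shows "2 * card A * q_int q (n - k) \<le> 2 * card (up_shadow A) + card A * (card A - 1)"
proof -
  have "finite A"
    using assms by (rule finite_level_subset)
  then show ?thesis
    using assms
  proof (induction A rule: finite_induct)
    case (insert x A)
    have x: "x \<in> level k" and A: "A \<subseteq> level k"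
      using insert.prems by auto
    have "A \<subseteq> P"
      using A by (auto simp: level_def)
    then have fin: "finite (up_shadow A)"
      by (rule finite_up_shadow)
    \<comment> \<open>The new element x shares at most one upper cover with each element already
      present.\<close>
    have "card (upper x \<inter> up_shadow A) \<le> (\<Sum>x'\<in>A. card (upper x \<inter> upper x'))"
      unfolding up_shadow_def Int_UN_distrib by (rule card_UN_le) fact
    also have "\<dots> \<le> (\<Sum>x'\<in>A. 1)"
    proof (rule sum_mono)
      fix x' assume "x' \<in> A"
      then have "x \<in> P" "x' \<in> P" "x \<noteq> x'" "rk x = rk x'"
        using insert.hyps x A by (auto simp: level_def)
      moreover from this have
        "upper x \<inter> upper x' = {y \<in> P. rk y = Suc (rk x) \<and> x \<sqsubseteq> y \<and> x' \<sqsubseteq> y}"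
        by (auto simp: upper_def)
      ultimately show "card (upper x \<inter> upper x') \<le> 1"
        using common_upper_le_1 by presburger
    qed
    finally have "card (upper x \<inter> up_shadow A) \<le> card A"
      by simp
    moreover have "up_shadow (insert x A) = upper x \<union> up_shadow A"
      by (simp add: up_shadow_def)
    moreover have "card (upper x) + card (up_shadow A)
        = card (upper x \<union> up_shadow A) + card (upper x \<inter> up_shadow A)"
      using fin by (intro card_Un_Int) auto
    ultimately have step: "q_int q (n - k) + card (up_shadow A) \<le> card (up_shadow (insert x A)) + card A"
      using card_upper_level[OF x] by simp
    have "card A * (card A - 1) + 2 * card A = Suc (card A) * card A"
      by (cases "card A") auto
    then show ?case
      using step insert.IH[OF A] insert.hyps by simp
  qed (simp add: up_shadow_def)
qed

text \<open>A second-moment argument. The norm bound limits the sum of the squared degrees d y =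
  |lower y \<inter> A| over the shadow, while the sum of the degrees is fixed by double counting; by
  Cauchy-Schwarz they must then spread over many y.\<close>

lemma up_shadow_spectral:
  assumes A: "A \<subseteq> level m" "A \<noteq> {}" and n: "n = Suc (2 * m)" and half: "2 * card A \<le> card (level m)"
  shows "2 * q * card A < (q + 1) * card (up_shadow A)"
proof -
  define a N s D lam where
    "a = real (card A)" and "N = real (card (level m))" and "s = real (card (up_shadow A))"
    and "D = real (q_int q (Suc m))" and "lam = real (q * q_int q m * q_int q m)"
  have fA: "finite A"
    using A(1) by (rule finite_level_subset)
  have a: "a > 0" "2 * a \<le> N"
    using A fA half by (auto simp: a_def N_def card_gt_0_iff)
  then have N: "N > 0" by linarith
  have card_up: "q_int q (n - m) = q_int q (Suc m)"
    using n by (simp add: Suc_diff_le)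
  \<comment> \<open>For n = 2m + 1 the degrees between the two middle levels agree, so both levels
    have size \<open>N\<close>.\<close>
  have NS: "real (card (level (Suc m))) = N"
    using card_level_Suc[of m] unfolding card_up N_def by (simp add: q_int_Suc del: mult_Suc_right)
  define d where "d y = real (card (lower y \<inter> A))" for y
  have sub: "up_shadow A \<subseteq> level (Suc m)"
    by (rule up_shadow_level[OF A(1)])
  have d0: "d y = 0" if "y \<in> level (Suc m) - up_shadow A" for y
    using degree_outside_up_shadow[OF A(1) that] by (simp add: d_def)
  have sum_d: "(\<Sum>y\<in>up_shadow A. d y) = a * D"
    using arg_cong[OF sum_degree_up_shadow[OF A(1)], of real]
    by (simp add: d_def a_def D_def card_up)
  have sum_d': "(\<Sum>y\<in>level (Suc m). d y) = a * D"
    unfolding sum_d[symmetric] by (rule sum.mono_neutral_right) (use sub d0 in auto)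
  \<comment> \<open>The indicator of A minus its mean, so that \<open>up_operator_norm\<close>
    applies.\<close>
  define f where "f x = (if x \<in> A then 1 else 0) - a / N" for x
  have sum_ind: "(\<Sum>x\<in>level m. if x \<in> A then c else 0) = c * a" for c :: real
    using A by (simp flip: sum.inter_restrict add: inf.absorb2 a_def)
  have f0: "(\<Sum>x\<in>level m. f x) = 0"
    using N sum_ind[of 1] by (simp add: f_def sum_subtractf flip: N_def)
  have f2: "(\<Sum>x\<in>level m. (f x)\<^sup>2) = a * (1 - a / N)"
  proof -
    have "(\<Sum>x\<in>level m. (f x)\<^sup>2)
        = (\<Sum>x\<in>level m. (if x \<in> A then 1 - 2 * a / N else 0) + (a / N)\<^sup>2)"
      by (intro sum.cong) (auto simp: f_def power2_eq_square algebra_simps)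
    also have "\<dots> = (1 - 2 * a / N) * a + N * (a / N)\<^sup>2"
      by (simp add: sum.distrib sum_ind flip: N_def)
    also have "\<dots> = a * (1 - a / N)"
      using N by (simp add: power2_eq_square field_simps)
    finally show ?thesis .
  qed
  have Uf: "(\<Sum>x\<in>lower y. f x) = d y - D * (a / N)" if "y \<in> level (Suc m)" for y
    using that
    by (simp add: f_def d_def D_def sum_subtractf card_lower_level flip: sum.inter_restrict)
  have "(\<Sum>y\<in>level (Suc m). (\<Sum>x\<in>lower y. f x)\<^sup>2)
      = (\<Sum>y\<in>level (Suc m). (d y)\<^sup>2 - 2 * D * (a / N) * d y + (D * (a / N))\<^sup>2)"
    by (intro sum.cong) (auto simp: Uf power2_eq_square algebra_simps)
  also have "\<dots> = (\<Sum>y\<in>level (Suc m). (d y)\<^sup>2) - 2 * D * (a / N) * (a * D) + N * (D * (a / N))\<^sup>2"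
    unfolding sum.distrib sum_subtractf sum_distrib_left[symmetric] sum_d' by (simp add: NS)
  also have "\<dots> = (\<Sum>y\<in>level (Suc m). (d y)\<^sup>2) - D\<^sup>2 * a * (a / N)"
    using N by (simp add: power2_eq_square field_simps)
  finally have "(\<Sum>y\<in>level (Suc m). (d y)\<^sup>2) - D\<^sup>2 * a * (a / N) \<le> lam * (a * (1 - a / N))"
    using up_operator_norm[OF _ f0] n f2 by (simp add: lam_def)
  moreover have "(\<Sum>y\<in>level (Suc m). (d y)\<^sup>2) = (\<Sum>y\<in>up_shadow A. (d y)\<^sup>2)"
    by (rule sum.mono_neutral_right) (use sub d0 in auto)
  ultimately have d2: "(\<Sum>y\<in>up_shadow A. (d y)\<^sup>2) \<le> a * (lam + (D\<^sup>2 - lam) * (a / N))"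
    by (simp add: algebra_simps)
  have q: "real q \<ge> 2"
    using q_ge_2 by simp
  have D: "D = real q * q_int q m + 1"
    by (simp add: D_def q_int_Suc)
  then have "D > 0"
    by (simp add: add_nonneg_pos)
  \<comment> \<open>Since D = q [m] + 1 and \<open>lam\<close> = q [m]^2, the left side equals (D -
    1)^2.\<close>
  have lamD: "real q * lam < D\<^sup>2"
    by (simp add: D lam_def power2_eq_square algebra_simps add_pos_nonneg)
  have "lam \<ge> 0"
    by (simp add: lam_def)
  then have "1 * lam \<le> real q * lam"
    using q by (intro mult_right_mono) auto
  then have "lam \<le> D\<^sup>2"
    using lamD by linarith
  moreover have "a / N \<le> 1 / 2"
    using a N by (simp add: field_simps)
  \<comment> \<open>This is where the density of at most one half enters.\<close>
  ultimately have "(D\<^sup>2 - lam) * (a / N) \<le> (D\<^sup>2 - lam) * (1 / 2)"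
    by (intro mult_left_mono) auto
  then have "lam + (D\<^sup>2 - lam) * (a / N) \<le> (D\<^sup>2 + lam) / 2"
    by (simp add: field_simps)
  then have "(\<Sum>y\<in>up_shadow A. (d y)\<^sup>2) \<le> a * ((D\<^sup>2 + lam) / 2)"
    using d2 a by (meson mult_left_mono less_imp_le order_trans)
  moreover have "(a * D)\<^sup>2 \<le> s * (\<Sum>y\<in>up_shadow A. (d y)\<^sup>2)"
    using Cauchy_Schwarz_ineq_sum[of "\<lambda>_. 1" d "up_shadow A"] by (simp add: sum_d s_def)
  moreover have s0: "s \<ge> 0"
    by (simp add: s_def)
  ultimately have "(a * D)\<^sup>2 \<le> s * (a * ((D\<^sup>2 + lam) / 2))"
    by (meson mult_left_mono order_trans)
  then have "a * (2 * a * D\<^sup>2) \<le> a * (s * (D\<^sup>2 + lam))"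
    by (simp add: power2_eq_square algebra_simps)
  then have main: "2 * a * D\<^sup>2 \<le> s * (D\<^sup>2 + lam)"
    using a by simp
  have "s > 0"
  proof (rule ccontr)
    assume "\<not> s > 0"
    then have "s = 0" using s0 by simp
    then have "2 * a * D\<^sup>2 \<le> 0" using main by simp
    moreover have "2 * a * D\<^sup>2 > 0" using a \<open>D > 0\<close> by simp
    ultimately show False by linarith
  qed
  have "2 * q * a * D\<^sup>2 \<le> s * (q * D\<^sup>2 + q * lam)"
    using mult_left_mono[OF main, of "real q"] by (simp add: algebra_simps)
  also have "\<dots> < s * (q * D\<^sup>2 + D\<^sup>2)"
    using lamD \<open>s > 0\<close> by simp
  finally have "(2 * q * a) * D\<^sup>2 < ((q + 1) * s) * D\<^sup>2"
    by (simp add: algebra_simps)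
  then have "2 * q * a < (q + 1) * s"
    using \<open>D > 0\<close> by simp
  then have "real (2 * q * card A) < real ((q + 1) * card (up_shadow A))"
    by (simp add: a_def s_def algebra_simps)
  then show ?thesis
    by linarith
qed

lemma up_shadow_mono: "A \<subseteq> B \<Longrightarrow> up_shadow A \<subseteq> up_shadow B"
  by (auto simp: up_shadow_def)

lemma q_times_q_int_ge_2: "m > 0 \<Longrightarrow> 2 \<le> q * q_int q m"
  using mult_le_mono[OF q_ge_2, of 1 "q_int q m"] q_int_strict_mono[of q 0 m] q_ge_2 by simp

text \<open>Few elements have nearly disjoint sets of upper covers; for many elements the ratio of the
  degrees suffices.\<close>

lemma up_shadow_gain_below_middle:
  assumes A: "A \<subseteq> level k" "A \<noteq> {}" and k: "2 * Suc k \<le> n"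
  shows "card A + q * q_int q (Suc k) \<le> card (up_shadow A)"
    and "card (up_shadow A) = card A + q * q_int q (Suc k) \<Longrightarrow> card A = 1 \<and> n = 2 * Suc k"
proof -
  define a s e where "a = card A" and "s = card (up_shadow A)" and "e = q * q_int q (Suc k)"
  have a: "a > 0"
    using A finite_level_subset[OF A(1)] by (simp add: a_def card_gt_0_iff)
  have "a + e \<le> s \<and> (s = a + e \<longrightarrow> a = 1 \<and> n = 2 * Suc k)"
  proof (cases "a \<le> e")
    case True
    have D: "Suc e \<le> q_int q (n - k)"
      using q_int_mono[of "Suc (Suc k)" "n - k" q] k by (simp add: e_def q_int_Suc)
    have e: "e \<ge> 2"
      unfolding e_def by (rule q_times_q_int_ge_2) simp
    note pairs = up_shadow_pairs[OF A(1), folded a_def s_def]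
    have gain: "a + e \<le> s" "a > 1 \<Longrightarrow> a + e < s"
      using pair_bound_gain[OF pairs D a _ e] True by auto
    \<comment> \<open>Equality forces a = 1. For larger n the up-degree of that single element
      already exceeds 1 + e.\<close>
    have "n = 2 * Suc k" if "s = a + e"
    proof (rule ccontr)
      assume "n \<noteq> 2 * Suc k"
      then have "Suc e < q_int q (n - k)"
        using q_int_strict_mono[of q "Suc (Suc k)" "n - k"] k q_ge_2 by (simp add: e_def q_int_Suc)
      moreover have "a = 1"
        using gain a that by linarith
      ultimately show False
        using pairs that by simp
    qed
    then show ?thesis
      using gain a by fastforce
  next
    case False
    \<comment> \<open>Now a > e. Splitting [k+2] as [k+1] + q^(k+1) leaves the surplus a q^(k+1),
      which beats e [k+1] factor by factor.\<close>
    have "a * q_int q (Suc (Suc k)) \<le> a * q_int q (n - k)"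
      using q_int_mono[of "Suc (Suc k)" "n - k" q] k by simp
    also have "\<dots> \<le> s * q_int q (Suc k)"
      using up_shadow_ratio[OF A(1)] by (simp add: a_def s_def)
    finally have "a * q ^ Suc k + a * q_int q (Suc k) \<le> s * q_int q (Suc k)"
      by (simp add: q_int_Suc'[of q "Suc k"] algebra_simps)
    moreover have "e * q_int q (Suc k) < a * q ^ Suc k"
      using False q_int_less_power[OF q_ge_2, of "Suc k"] by (intro mult_strict_mono) auto
    ultimately have "(a + e) * q_int q (Suc k) < s * q_int q (Suc k)"
      by (simp add: algebra_simps)
    then show ?thesis
      by simp
  qed
  then show "card A + q * q_int q (Suc k) \<le> card (up_shadow A)"
    and "card (up_shadow A) = card A + q * q_int q (Suc k) \<Longrightarrow> card A = 1 \<and> n = 2 * Suc k"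
    by (auto simp: a_def s_def e_def)
qed

lemma card_level_1: "card (level 1) = q_int q n"
  using card_level_Suc[of 0] card_bottom by (simp add: level_def q_int_Suc)

text \<open>Between the two middle levels the ratio of the degrees is 1, and the spectral bound takes its
  place. Only the Fano plane (\<open>q = 2\<close>, \<open>m = 1\<close>) escapes it, and there no set of at most half the
  points is large.\<close>

lemma up_shadow_gain_middle:
  assumes A: "A \<subseteq> level m" "A \<noteq> {}" and n: "n = Suc (2 * m)" and m: "m > 0"
    and half: "2 * card A \<le> card (level m)"
  shows "card A + q * q_int q m \<le> card (up_shadow A)"
    and "card (up_shadow A) = card A + q * q_int q m \<Longrightarrow> card A = 1"
proof -
  define a s e where "a = card A" and "s = card (up_shadow A)" and "e = q * q_int q m"
  have a: "a > 0"
    using A finite_level_subset[OF A(1)] by (simp add: a_def card_gt_0_iff)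
  have e: "e \<ge> 2"
    unfolding e_def by (rule q_times_q_int_ge_2) fact
  have D: "q_int q (n - m) = Suc e"
    using n by (simp add: e_def Suc_diff_le flip: q_int_Suc)
  \<comment> \<open>The pair bound is effective up to a = e + 1. Beyond that a subset of this size
    suffices as long as a \<le> e (e+1) / 2, and the spectral bound takes over for larger a.\<close>
  consider "a \<le> Suc e" | "Suc e < a" "2 * a \<le> Suc e * e" | "Suc e * e < 2 * a"
    by linarith
  then have "a + e \<le> s \<and> (s = a + e \<longrightarrow> a = 1)"
  proof cases
    case 1
    then show ?thesis
      using pair_bound_gain[OF up_shadow_pairs[OF A(1), folded a_def s_def, unfolded D] _ a _ e] a
      by fastforce
  next
    case 2
    \<comment> \<open>The pair bound gives e + 1 elements a shadow of size at least (e+1)(e+2)/2,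
      which is e (e+1) / 2 plus e + 1 and thus exceeds a + e.\<close>
    then obtain A' where A': "A' \<subseteq> A" "card A' = Suc e"
      unfolding a_def by (metis less_imp_le obtain_subset_with_card_n)
    have "2 * card A' * Suc e \<le> 2 * card (up_shadow A') + card A' * (card A' - 1)"
      using up_shadow_pairs[of A' m] A A' unfolding D by auto
    moreover have "card (up_shadow A') \<le> s"
      unfolding s_def using A A' by (intro card_mono up_shadow_mono finite_up_shadow) (auto simp: level_def)
    ultimately have "2 * Suc e * Suc e \<le> 2 * s + Suc e * e"
      unfolding A' by simp
    then have "Suc e * e + 2 * Suc e \<le> 2 * s"
      by (simp add: algebra_simps)
    moreover define t where "t = Suc e * e"
    ultimately have "a + e < s"
      using 2 unfolding t_def[symmetric] by simp
    then show ?thesis by simp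
  next
    case 3
    have spec: "2 * q * a < (q + 1) * s"
      unfolding a_def s_def using up_shadow_spectral[OF A n half] .
    have "a + e < s"
    proof (rule ccontr)
      assume "\<not> a + e < s"
      then have "(q + 1) * s \<le> (q + 1) * (a + e)"
        by (intro mult_le_mono2) simp
      with spec have "2 * q * a < (q + 1) * (a + e)"
        by linarith
      \<comment> \<open>With p = q - 1 a failure means p a < (p+2) e. Together with 2a > e (e+1) and
        e \<ge> q this leaves only p = 1, and then m = 1.\<close>
      moreover obtain p where p: "q = Suc p"
        using q_ge_2 by (cases q) auto
      ultimately have "p * a < (p + 2) * e"
        by (simp add: algebra_simps)
      moreover have "p * (Suc e * e) \<le> p * (2 * a)"
        using 3 by (intro mult_le_mono2) simp
      ultimately have "(p * Suc e) * e < (2 * (p + 2)) * e"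
        by (simp only: mult.assoc mult.left_commute[of p 2])
      then have small: "p * Suc e < 2 * (p + 2)"
        using mult_less_cancel2 by blast
      have qm: "q_int q m \<ge> 1"
        using q_int_strict_mono[of q 0 m] q_ge_2 m by simp
      have "p * (p + 2) \<le> p * Suc e"
        using mult_le_mono2[OF qm, of q] unfolding e_def p by (intro mult_le_mono2) simp
      with small have "p * (p + 2) < 2 * (p + 2)"
        by linarith
      then have "p < 2"
        using mult_less_cancel2 by blast
      then have "q = 2"
        using p q_ge_2 by simp
      then have "e < 5"
        using small p by simp
      have "m = 1"
      proof (rule ccontr)
        assume "m \<noteq> 1"
        then have "q_int q 2 \<le> q_int q m"
          using m by (intro q_int_mono) simp
        then show False
          using \<open>e < 5\<close> \<open>q = 2\<close> by (simp add: e_def numeral_2_eq_2 q_int_Suc)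
      qed
      \<comment> \<open>In the Fano plane 2a > 6 means at least four of seven points, more than
        half.\<close>
      then have "card (level m) = 7" "e = 2"
        using card_level_1 n \<open>q = 2\<close> by (simp_all add: e_def numeral_3_eq_3 q_int_Suc)
      then show False
        using 3 half by (simp add: a_def)
    qed
    then show ?thesis by simp
  qed
  then show "card A + q * q_int q m \<le> card (up_shadow A)"
    and "card (up_shadow A) = card A + q * q_int q m \<Longrightarrow> card A = 1"
    by (auto simp: a_def s_def e_def)
qed

subsection \<open>Pushing antichains to the middle\<close>

text \<open>A shadow element has the least rank in F', so in a comparable pair it can only be the
  lower one. A member of level k beneath it would then, by transitivity, already be comparable to a
  member of F. The same reason makes the shadow disjoint from the rest, so sizes add.\<close>

lemma push_step:
  assumes F: "incomparable F" and k: "\<forall>x\<in>F. k \<le> rk x"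
  defines "F' \<equiv> (F - level k) \<union> up_shadow (F \<inter> level k)"
  shows "incomparable F'" "\<forall>x\<in>F'. Suc k \<le> rk x"
    and "(F - level k) \<inter> up_shadow (F \<inter> level k) = {}"
    and "card F' + card (F \<inter> level k) = card F + card (up_shadow (F \<inter> level k))"
proof -
  have FP: "F \<subseteq> P" and anti: "\<And>x y. \<lbrakk>x \<in> F; y \<in> F; x \<noteq> y\<rbrakk> \<Longrightarrow> \<not> x \<sqsubseteq> y"
    using F by (auto simp: incomparable_def)
  have sh: "\<exists>x\<in>F. x \<sqsubseteq> y \<and> y \<in> P \<and> x \<in> P \<and> rk y = Suc k \<and> rk x = k"
    if "y \<in> up_shadow (F \<inter> level k)" for y
    using that by (auto simp: up_shadow_def upper_def level_def)
  have rest: "y \<in> P \<and> Suc k \<le> rk y" if "y \<in> F - level k" for y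
    using that k FP by (fastforce simp: level_def Suc_le_eq order_less_le)
  have F'P: "F' \<subseteq> P"
    using FP sh by (auto simp: F'_def)
  show rk': "\<forall>x\<in>F'. Suc k \<le> rk x"
    unfolding F'_def using rest sh by fastforce
  show disj: "(F - level k) \<inter> up_shadow (F \<inter> level k) = {}"
  proof (rule ccontr)
    assume "\<not> ?thesis"
    then obtain y where "y \<in> F" "y \<in> up_shadow (F \<inter> level k)" by auto
    then show False
      using sh[of y] anti by fastforce
  qed
  show "incomparable F'"
    unfolding incomparable_def
  proof (intro conjI F'P ballI impI notI)
    fix y z assume y: "y \<in> F'" and z: "z \<in> F'" and "y \<noteq> z" "y \<sqsubseteq> z"
    have P: "y \<in> P" "z \<in> P"
      using y z F'P by auto
    show False
    proof (cases "z \<in> F - level k")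
      case True
      show False
      proof (cases "y \<in> F - level k")
        case True
        then show False
          using \<open>z \<in> F - level k\<close> anti \<open>y \<noteq> z\<close> \<open>y \<sqsubseteq> z\<close> by blast
      next
        case False
        then obtain x where x: "x \<in> F" "x \<sqsubseteq> y" "x \<in> P" "rk x = k"
          using y sh[of y] by (auto simp: F'_def)
        then have "x \<sqsubseteq> z"
          using le_trans[of x y z] P \<open>y \<sqsubseteq> z\<close> by simp
        moreover have "x \<noteq> z"
          using x rest[OF True] by auto
        ultimately show False
          using anti x True by blast
      qed
    next
      case False
      then have "rk z = Suc k"
        using z sh[of z] by (auto simp: F'_def)
      then have "rk y = rk z"
        using rk' y rk_mono[OF P \<open>y \<sqsubseteq> z\<close>] by fastforce
      then show False
        using le_rk_eq[OF P \<open>y \<sqsubseteq> z\<close>] \<open>y \<noteq> z\<close> by simp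
    qed
  qed
  have "finite F"
    using FP by (rule finite_subset_P)
  moreover have "finite (up_shadow (F \<inter> level k))"
    using FP by (intro finite_up_shadow) auto
  ultimately have "card F' = card (F - level k) + card (up_shadow (F \<inter> level k))"
    unfolding F'_def using disj by (intro card_Un_disjoint) auto
  moreover have "card F = card (F - level k) + card (F \<inter> level k)"
    using card_Int_Diff[OF \<open>finite F\<close>, of "level k"] by simp
  ultimately show "card F' + card (F \<inter> level k) = card F + card (up_shadow (F \<inter> level k))"
    by simp
qed

text \<open>Beyond the new antichain, the invariant records what later steps need: ranks above j are
  untouched, so that a push from the other side can be combined with it; level j is occupied if
  anything lay at or below it; and any actual change strictly increases the size, which settles
  equality.\<close>

lemma push_up:
  assumes "incomparable F" "2 * j \<le> n"
  shows "\<exists>F'. incomparable F' \<and> (\<forall>x\<in>F'. j \<le> rk x) \<and> {x\<in>F'. j < rk x} = {x\<in>F. j < rk x}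
    \<and> ((\<exists>x\<in>F. rk x \<le> j) \<longrightarrow> (\<exists>x\<in>F'. rk x = j)) \<and> (F' = F \<or> card F < card F')"
  using assms(2)
proof (induction j)
  case 0
  then show ?case
    using assms(1) by auto
next
  case (Suc j)
  then obtain F1 where F1: "incomparable F1" "\<forall>x\<in>F1. j \<le> rk x" "{x\<in>F1. j < rk x} = {x\<in>F. j < rk x}"
      "(\<exists>x\<in>F. rk x \<le> j) \<longrightarrow> (\<exists>x\<in>F1. rk x = j)" "F1 = F \<or> card F < card F1"
    by auto
  have iff: "x \<in> F1 \<longleftrightarrow> x \<in> F" if "j < rk x" for x
    using F1(3) that by auto
  define A where "A = F1 \<inter> level j"
  have F1P: "F1 \<subseteq> P"
    using F1(1) by (simp add: incomparable_def)
  show ?case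
  proof (cases "A = {}")
    case True
    then have none: "\<forall>x\<in>F1. rk x \<noteq> j"
      using F1P by (auto simp: A_def level_def)
    then have "\<forall>x\<in>F1. Suc j \<le> rk x"
      using F1(2) by (auto simp: Suc_le_eq order_less_le)
    moreover have "\<exists>x\<in>F1. rk x = Suc j" if "\<exists>x\<in>F. rk x \<le> Suc j"
      using that none F1(4) iff by (metis le_SucE lessI)
    ultimately show ?thesis
      using F1 iff by (intro exI[of _ F1]) auto
  next
    case False
    define F2 where "F2 = (F1 - level j) \<union> up_shadow A"
    note step = push_step[OF F1(1,2), folded A_def, folded F2_def]
    have sub: "A \<subseteq> level j"
      by (simp add: A_def)
    have gt: "q_int q (Suc j) < q_int q (n - j)"
      using Suc.prems q_ge_2 by (intro q_int_strict_mono) auto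
    have "card A > 0"
      using False finite_level_subset[OF sub] by (simp add: card_gt_0_iff)
    then have "card A * q_int q (Suc j) < card A * q_int q (n - j)"
      using gt by simp
    also have "\<dots> \<le> card (up_shadow A) * q_int q (Suc j)"
      by (rule up_shadow_ratio[OF sub])
    finally have "card A < card (up_shadow A)"
      using mult_less_cancel2 by blast
    then have "card F < card F2"
      using step(4) F1(5) by auto
    moreover have "{x \<in> F2. Suc j < rk x} = {x \<in> F. Suc j < rk x}"
      using iff up_shadow_level[OF sub] by (auto simp: F2_def level_def)
    moreover have "up_shadow A \<noteq> {}"
      using \<open>card A < card (up_shadow A)\<close> by auto
    then have "\<exists>x\<in>F2. rk x = Suc j"
      using up_shadow_level[OF sub] by (auto simp: F2_def level_def)
    ultimately show ?thesis
      using step by (intro exI[of _ F2]) auto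
  qed
qed

section \<open>Duality and bounds at the middle levels\<close>

lemma dual_incomparable:
  "q_regular_poset.incomparable P (\<lambda>x y. y \<sqsubseteq> x) F \<longleftrightarrow> incomparable F"
proof -
  interpret dual: q_regular_poset P "\<lambda>x y. y \<sqsubseteq> x" "\<lambda>x. n - rk x" n q
    by (rule dual)
  show ?thesis
    unfolding dual.incomparable_def incomparable_def by metis
qed

lemma dual_level:
  assumes "k \<le> n"
  shows "q_regular_poset.level P (\<lambda>x. n - rk x) k = level (n - k)"
proof -
  interpret dual: q_regular_poset P "\<lambda>x y. y \<sqsubseteq> x" "\<lambda>x. n - rk x" n q
    by (rule dual)
  show ?thesis
    unfolding dual.level_def level_def using rk_le assms by force
qed

lemma push_down:
  assumes "incomparable F" "2 * j \<le> n"
  shows "\<exists>F'. incomparable F' \<and> (\<forall>x\<in>F'. rk x \<le> n - j) \<and> {x\<in>F'. rk x < n - j} = {x\<in>F. rk x < n - j}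
    \<and> (F' = F \<or> card F < card F')"
proof -
  interpret dual: q_regular_poset P "\<lambda>x y. y \<sqsubseteq> x" "\<lambda>x. n - rk x" n q
    by (rule dual)
  obtain F' where F': "incomparable F'" "\<forall>x\<in>F'. j \<le> n - rk x"
      "{x\<in>F'. j < n - rk x} = {x\<in>F. j < n - rk x}" "F' = F \<or> card F < card F'"
    using dual.push_up[of F j] assms unfolding dual_incomparable by blast
  have "rk x < n - j \<longleftrightarrow> j < n - rk x" for x
    by linarith
  moreover have "\<forall>x\<in>F'. rk x \<le> n - j"
    using F'(1,2) rk_le assms(2) by (fastforce simp: incomparable_def)
  ultimately show ?thesis
    using F' by auto
qed

lemma card_level_middle:
  assumes "m = n div 2"
  shows "card (level (n - m)) = card (level m)"
proof (cases "even n")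
  case False
  then have "n = Suc (2 * m)" "n - m = Suc m"
    using assms by presburger+
  then show ?thesis
    using card_level_Suc[of m] by (simp add: q_int_Suc del: mult_Suc_right)
qed (use assms in auto)

text \<open>For odd n a push from level m to level m + 1 loses nothing, because the degrees agree;
  the result lies in one level.\<close>

lemma card_two_levels:
  assumes F: "incomparable F" and m: "m = n div 2" and rk: "\<forall>x\<in>F. m \<le> rk x \<and> rk x \<le> n - m"
  shows "card F \<le> card (level m)"
proof (cases "even n")
  case True
  then have "F \<subseteq> level m"
    using F rk m by (fastforce simp: incomparable_def level_def)
  then show ?thesis
    by (simp add: card_mono)
next
  case False
  then have n: "n - m = Suc m"
    using m by presburger
  define A where "A = F \<inter> level m"
  note step = push_step[OF F, of m, folded A_def]
  have sub: "A \<subseteq> level m"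
    by (simp add: A_def)
  have "card A \<le> card (up_shadow A)"
    using up_shadow_ratio[OF sub] n by (simp add: q_int_Suc del: mult_Suc_right)
  moreover have "F - level m \<subseteq> level (Suc m)"
    using F rk n by (fastforce simp: incomparable_def level_def le_Suc_eq)
  then have "card (F - level m \<union> up_shadow A) \<le> card (level (Suc m))"
    using up_shadow_level[OF sub] by (intro card_mono) auto
  ultimately show ?thesis
    using step(4) rk card_level_middle[OF m] n by simp
qed

text \<open>Recovers an extremal antichain from its pushed image: the shadow of U is disjoint from
  the rest, so the rest is its complement in the level.\<close>

lemma star_family_of_push:
  assumes F: "incomparable F" "\<forall>x\<in>F. k \<le> rk x" and U: "F \<inter> level k = {U}"
    and F': "(F - level k) \<union> up_shadow {U} = level (Suc k)"
  shows "F = {x \<in> level (Suc k). \<not> U \<sqsubseteq> x} \<union> {U}"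
proof -
  have "up_shadow {U} = {x \<in> level (Suc k). U \<sqsubseteq> x}"
    using U by (auto simp: up_shadow_def upper_def level_def)
  moreover have "(F - level k) \<inter> up_shadow {U} = {}"
    using push_step(3)[OF F] U by simp
  ultimately have "F - level k = {x \<in> level (Suc k). \<not> U \<sqsubseteq> x}"
    using F' by blast
  then show ?thesis
    using U by blast
qed

text \<open>The alternatives are a member below level m, and an odd n with all members in the two
  middle levels and a nonempty part in the lower one of at most half its size. In either case one
  last push gains q [m] and ends in an antichain no larger than a middle level.\<close>

lemma one_sided_bound:
  assumes F: "incomparable F" and n: "n > 1" and m: "m = n div 2"
    and cases: "(\<exists>x\<in>F. rk x < m) \<or>
      (n = Suc (2 * m) \<and> (\<forall>x\<in>F. m \<le> rk x \<and> rk x \<le> Suc m) \<and> F \<inter> level m \<noteq> {}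
        \<and> 2 * card (F \<inter> level m) \<le> card (level m))"
  shows "card F + q * q_int q m \<le> card (level m) \<and>
    (card F + q * q_int q m = card (level m) \<longrightarrow>
      (\<exists>U\<in>level (n - m - 1). F = {x \<in> level (n - m). \<not> U \<sqsubseteq> x} \<union> {U}))"
  using cases
proof
  assume low: "\<exists>x\<in>F. rk x < m"
  obtain k where k: "m = Suc k" "2 * k \<le> n" "2 * Suc k \<le> n"
    using n m that[of "m - 1"] by auto
  obtain F1 where F1: "incomparable F1" "\<forall>x\<in>F1. k \<le> rk x"
      "(\<exists>x\<in>F. rk x \<le> k) \<longrightarrow> (\<exists>x\<in>F1. rk x = k)" "F1 = F \<or> card F < card F1"
    using push_up[OF F k(2)] by auto
  obtain F2 where F2: "incomparable F2" "\<forall>x\<in>F2. rk x \<le> n - m"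
      "{x\<in>F2. rk x < n - m} = {x\<in>F1. rk x < n - m}" "F2 = F1 \<or> card F1 < card F2"
    using push_down[OF F1(1), of m] k by auto
  \<comment> \<open>Pushing down leaves ranks below n - m alone, so level k = m - 1 stays occupied
    for the final push.\<close>
  have iff: "x \<in> F2 \<longleftrightarrow> x \<in> F1" if "rk x < n - m" for x
    using F2(3) that by auto
  have F2P: "F2 \<subseteq> P"
    using F2(1) by (simp add: incomparable_def)
  have k_less: "k < n - m"
    using k m by simp
  have lo: "\<forall>x\<in>F2. k \<le> rk x"
    using F1(2) F2(2) iff k_less by (metis le_less_linear less_imp_le order.trans)
  obtain z where z: "z \<in> F1" "rk z = k"
    using low F1(3) k(1) less_Suc_eq_le by auto
  define A where "A = F2 \<inter> level k"
  have A: "A \<subseteq> level k" "A \<noteq> {}"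
    using z iff[of z] k_less F2P by (auto simp: A_def level_def)
  define F3 where "F3 = (F2 - level k) \<union> up_shadow A"
  note step = push_step[OF F2(1) lo, folded A_def, folded F3_def]
  have "\<forall>x\<in>F3. m \<le> rk x \<and> rk x \<le> n - m"
    using step(2) k F2(2) up_shadow_level[OF A(1)] k_less by (fastforce simp: F3_def level_def)
  then have F3_le: "card F3 \<le> card (level m)"
    by (rule card_two_levels[OF step(1) m])
  note gain = up_shadow_gain_below_middle[OF A k(3), folded k(1)]
  have "card F2 + q * q_int q m \<le> card (level m)"
    using step(4) F3_le gain(1) by simp
  moreover have "card F \<le> card F2"
    using F1(4) F2(4) by auto
  moreover have "\<exists>U\<in>level (n - m - 1). F = {x \<in> level (n - m). \<not> U \<sqsubseteq> x} \<union> {U}"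
    if eq: "card F + q * q_int q m = card (level m)"
  proof -
    \<comment> \<open>Under equality neither preliminary push may have changed anything, as a change
      would strictly enlarge the antichain.\<close>
    have "card F = card F2"
      using calculation eq by simp
    then have F2_eq: "F2 = F"
      using F1(4) F2(4) by auto
    have "card (up_shadow A) = card A + q * q_int q m"
      using step(4) F3_le gain(1) eq unfolding F2_eq by linarith
    then have "card A = 1" and n2: "n = 2 * m"
      using gain(2) by auto
    then obtain U where U: "A = {U}"
      by (auto simp: card_1_singleton_iff)
    have "F3 \<subseteq> level m"
      using \<open>\<forall>x\<in>F3. m \<le> rk x \<and> rk x \<le> n - m\<close> n2 step(1) by (fastforce simp: incomparable_def level_def)
    moreover have "card F3 = card (level m)"
      using step(4) F3_le gain(1) eq unfolding F2_eq by linarith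
    ultimately have "F3 = level m"
      by (simp add: card_subset_eq)
    then have "F = {x \<in> level (Suc k). \<not> U \<sqsubseteq> x} \<union> {U}"
      using star_family_of_push[OF F2(1) lo, of U] U unfolding F3_def A_def F2_eq k(1) by simp
    moreover have "n - m - 1 = k" "n - m = Suc k"
      using n2 k by auto
    ultimately show ?thesis
      using U A(1) by auto
  qed
  ultimately show ?thesis
    by (auto intro: order_trans)
next
  assume asm: "n = Suc (2 * m) \<and> (\<forall>x\<in>F. m \<le> rk x \<and> rk x \<le> Suc m) \<and> F \<inter> level m \<noteq> {}
    \<and> 2 * card (F \<inter> level m) \<le> card (level m)"
  define A where "A = F \<inter> level m"
  have n': "n = Suc (2 * m)" and lo: "\<forall>x\<in>F. m \<le> rk x"
    and A: "A \<subseteq> level m" "A \<noteq> {}" and half: "2 * card A \<le> card (level m)"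
    using asm unfolding A_def by blast+
  have nm: "n - m = Suc m"
    using n' by simp
  have "m > 0"
    using n n' by simp
  note gain = up_shadow_gain_middle[OF A n' this half]
  define F3 where "F3 = (F - level m) \<union> up_shadow A"
  note step = push_step[OF F lo, folded A_def, folded F3_def]
  have F3: "F3 \<subseteq> level (Suc m)"
  proof -
    have "rk x = m \<or> rk x = Suc m" if "x \<in> F" for x
      using asm that le_Suc_eq order_antisym by blast
    then have "F - level m \<subseteq> level (Suc m)"
      using F by (auto simp: incomparable_def level_def)
    then show ?thesis
      using up_shadow_level[OF A(1)] by (simp add: F3_def)
  qed
  then have F3_le: "card F3 \<le> card (level m)"
    using card_mono[of "level (Suc m)" F3] card_level_middle[OF m] nm by simp
  have "card F + q * q_int q m \<le> card (level m)"
    using step(4) F3_le gain(1) by simp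
  moreover have "\<exists>U\<in>level (n - m - 1). F = {x \<in> level (n - m). \<not> U \<sqsubseteq> x} \<union> {U}"
    if eq: "card F + q * q_int q m = card (level m)"
  proof -
    have "card (up_shadow A) = card A + q * q_int q m"
      using step(4) F3_le gain(1) eq by linarith
    then obtain U where U: "A = {U}"
      using gain(2) by (auto simp: card_1_singleton_iff)
    have "card F3 = card (level (Suc m))"
      using step(4) F3_le gain(1) eq card_level_middle[OF m] nm by simp
    with F3 have "F3 = level (Suc m)"
      by (simp add: card_subset_eq)
    then have "F = {x \<in> level (Suc m). \<not> U \<sqsubseteq> x} \<union> {U}"
      using star_family_of_push[OF F lo, of U] U unfolding F3_def A_def by simp
    then show ?thesis
      using U A(1) nm by auto
  qed
  ultimately show ?thesis
    by blast
qed

text \<open>A member above level n - m is a low member in the dual order. Duality exchanges levels m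
  and n - m and turns the family avoiding the elements above U into the one avoiding the elements
  below W.\<close>

lemma two_sided_bound:
  assumes F: "incomparable F" and n: "n > 1" and m: "m = n div 2"
    and not_middle: "\<not> F \<subseteq> level m" "\<not> F \<subseteq> level (n - m)"
  shows "card F + q * q_int q m \<le> card (level m) \<and>
    (card F + q * q_int q m = card (level m) \<longrightarrow>
      (\<exists>U\<in>level (n - m - 1). F = {x \<in> level (n - m). \<not> U \<sqsubseteq> x} \<union> {U}) \<or>
      (\<exists>W\<in>level (m + 1). F = {x \<in> level m. \<not> x \<sqsubseteq> W} \<union> {W}))"
proof -
  interpret dual: q_regular_poset P "\<lambda>x y. y \<sqsubseteq> x" "\<lambda>x. n - rk x" n q
    by (rule dual)
  have FP: "F \<subseteq> P"
    using F by (simp add: incomparable_def)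
  have levels: "dual.level m = level (n - m)" "dual.level (n - m) = level m"
      "dual.level (n - m - 1) = level (m + 1)"
    using dual_level[of m] dual_level[of "n - m"] dual_level[of "n - m - 1"] m n
    by (auto simp: Suc_diff_le)
  note dual_bound = dual.one_sided_bound[unfolded dual_incomparable, OF F n m,
      unfolded levels card_level_middle[OF m]]
  consider (low) "\<exists>x\<in>F. rk x < m" | (high) "\<exists>x\<in>F. n - m < rk x"
    | (mid) "\<forall>x\<in>F. m \<le> rk x \<and> rk x \<le> n - m"
    by (meson not_le)
  then show ?thesis
  proof cases
    case low
    then show ?thesis
      using one_sided_bound[OF F n m] by blast
  next
    case high
    then obtain x where x: "x \<in> F" "n - m < rk x" by blast
    then have "n - rk x < m"
      using n m by linarith
    with x(1) have "\<exists>x\<in>F. n - rk x < m" by blast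
    then show ?thesis
      using dual_bound by blast
  next
    case mid
    have odd: "n = Suc (2 * m)"
    proof (rule ccontr)
      assume "n \<noteq> Suc (2 * m)"
      then have "n - m = m" using m by presburger
      then show False
        using mid not_middle FP by (fastforce simp: level_def)
    qed
    then have nm: "n - m = Suc m" by simp
    have in_levels: "x \<in> level m \<or> x \<in> level (Suc m)" if "x \<in> F" for x
      using mid that FP nm by (auto simp: level_def le_Suc_eq)
    then have ne: "F \<inter> level m \<noteq> {}" "F \<inter> level (Suc m) \<noteq> {}"
      using not_middle nm by auto
    have "F = (F \<inter> level m) \<union> (F \<inter> level (Suc m))"
      using in_levels by auto
    moreover have "(F \<inter> level m) \<inter> (F \<inter> level (Suc m)) = {}"
      by (auto simp: level_def)
    ultimately have "card F = card (F \<inter> level m) + card (F \<inter> level (Suc m))"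
      by (metis card_Un_disjoint finite_Int finite_simps(1))
    moreover have "card F \<le> card (level m)"
      by (rule card_two_levels[OF F m mid])
    \<comment> \<open>The parts in the two middle levels are disjoint and together no larger than
      one level, so one of them is at most half.\<close>
    ultimately consider "2 * card (F \<inter> level m) \<le> card (level m)"
      | "2 * card (F \<inter> level (Suc m)) \<le> card (level m)"
      by linarith
    then show ?thesis
    proof cases
      case 1
      then show ?thesis
        using one_sided_bound[OF F n m] odd mid ne nm by auto
    next
      case 2
      have "\<forall>x\<in>F. m \<le> n - rk x \<and> n - rk x \<le> Suc m"
        using mid odd by auto
      then show ?thesis
        using dual_bound odd nm ne 2 by auto
    qed
  qed
qed

section \<open>Sizes of the extremal families and of the levels\<close>

lemma card_star_family:
  assumes n: "n > 1" and m: "m = n div 2" and U: "U \<in> level (n - m - 1)"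
  shows "card ({x \<in> level (n - m). \<not> U \<sqsubseteq> x} \<union> {U}) + q * q_int q m = card (level m)"
proof -
  have Suc: "Suc (n - m - 1) = n - m" "n - (n - m - 1) = Suc m"
    using n m by auto
  have "{x \<in> level (n - m). \<not> U \<sqsubseteq> x} = level (n - m) - upper U"
    using upper_level[OF U] Suc by auto
  moreover have sub: "upper U \<subseteq> level (n - m)"
    using upper_level[OF U] Suc by auto
  \<comment> \<open>Removing 1 + q [m] upper covers and adding U itself loses exactly q [m].\<close>
  moreover have "card (upper U) = Suc (q * q_int q m)"
    using card_upper_level[OF U] Suc by (simp add: q_int_Suc)
  moreover have "card (upper U) \<le> card (level (n - m))"
    using sub by (intro card_mono) auto
  moreover have "U \<notin> level (n - m)"
    using U Suc by (auto simp: level_def)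
  ultimately show ?thesis
    using card_level_middle[OF m] by (simp add: card_Diff_subset)
qed

lemma card_costar_family:
  assumes n: "n > 1" and m: "m = n div 2" and W: "W \<in> level (m + 1)"
  shows "card ({x \<in> level m. \<not> x \<sqsubseteq> W} \<union> {W}) + q * q_int q m = card (level m)"
proof -
  interpret dual: q_regular_poset P "\<lambda>x y. y \<sqsubseteq> x" "\<lambda>x. n - rk x" n q
    by (rule dual)
  have levels: "dual.level m = level (n - m)" "dual.level (n - m) = level m"
      "dual.level (n - m - 1) = level (m + 1)"
    using dual_level[of m] dual_level[of "n - m"] dual_level[of "n - m - 1"] m n
    by (auto simp: Suc_diff_le)
  show ?thesis
    using dual.card_star_family[OF n m, of W] W unfolding levels card_level_middle[OF m] by simp
qed

lemma card_level_gauss_binomial: "real (card (level k)) = gauss_binomial q n k"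
proof -
  have "card (level k) * (\<Prod>i<k. q_int q (Suc i)) = (\<Prod>i<k. q_int q (n - i))"
  proof (induction k)
    case 0
    then show ?case
      using card_bottom by (simp add: level_def)
  next
    case (Suc k)
    have "card (level (Suc k)) * (\<Prod>i<Suc k. q_int q (Suc i))
        = (card (level (Suc k)) * q_int q (Suc k)) * (\<Prod>i<k. q_int q (Suc i))"
      by (simp add: mult_ac)
    also have "\<dots> = (card (level k) * (\<Prod>i<k. q_int q (Suc i))) * q_int q (n - k)"
      unfolding card_level_Suc[symmetric] by (simp only: mult_ac)
    finally show ?case
      using Suc by simp
  qed
  then have "real (card (level k)) * (\<Prod>i<k. real (q_int q (Suc i))) = (\<Prod>i<k. real (q_int q (n - i)))"
    by (metis (no_types, lifting) of_nat_mult of_nat_prod prod.cong)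
  moreover have "(\<Prod>i<k. real (q_int q (Suc i))) = (\<Prod>i<k. real (q_int q (k - i)))"
    by (subst prod.nat_diff_reindex[symmetric]) (auto intro!: prod.cong simp: Suc_diff_Suc)
  moreover have "(\<Prod>i<k. real (q_int q (Suc i))) \<noteq> 0"
    by (simp add: q_int_Suc del: of_nat_Suc)
  ultimately have "real (card (level k)) = (\<Prod>i<k. real (q_int q (n - i)) / real (q_int q (k - i)))"
    by (simp add: prod_dividef nonzero_eq_divide_eq)
  \<comment> \<open>The factor q - 1 cancels in every quotient of the Gaussian binomial.\<close>
  moreover have "real q ^ j - 1 = (real q - 1) * real (q_int q j)" for j
    using power_diff_1_eq[of "real q" j] by (simp add: q_int_def)
  ultimately show ?thesis
    using q_ge_2 unfolding gauss_binomial_def by simp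
qed

end

subsection \<open>Subspaces over a finite field\<close>

locale finite_field_space = finite_dimensional_vector_space scale Basis
  for scale :: "'a::{field,finite} \<Rightarrow> 'b::ab_group_add \<Rightarrow> 'b" and Basis
begin

lemma card_span_insert:
  assumes "b \<notin> local.span B"
  shows "card (local.span (insert b B)) = CARD('a) * card (local.span B)"
proof -
  have "bij_betw (\<lambda>(k, x). x + scale k b) (UNIV \<times> local.span B) (local.span (insert b B))"
    unfolding bij_betw_def
  proof
    show "inj_on (\<lambda>(k, x). x + scale k b) (UNIV \<times> local.span B)"
    proof (rule inj_onI, clarify)
      fix k x k' x'
      assume x: "x \<in> local.span B" "x' \<in> local.span B" and eq: "x + scale k b = x' + scale k' b"
      have "k = k'"
      proof (rule ccontr)
        assume "k \<noteq> k'"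
        have "scale (k - k') b = x' - x"
          using eq by (simp add: scale_left_diff_distrib algebra_simps)
        then have "scale (k - k') b \<in> local.span B"
          using x span_diff by simp
        then have "scale (inverse (k - k')) (scale (k - k') b) \<in> local.span B"
          by (rule span_scale)
        then show False
          using \<open>k \<noteq> k'\<close> assms by simp
      qed
      then show "k = k' \<and> x = x'"
        using eq by simp
    qed
    show "(\<lambda>(k, x). x + scale k b) ` (UNIV \<times> local.span B) = local.span (insert b B)"
    proof (intro equalityI subsetI)
      fix v assume "v \<in> local.span (insert b B)"
      then obtain k where "v - scale k b \<in> local.span B"
        by (auto simp: span_breakdown_eq)
      then show "v \<in> (\<lambda>(k, x). x + scale k b) ` (UNIV \<times> local.span B)"
        by (intro image_eqI[of _ _ "(k, v - scale k b)"]) auto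
    next
      fix v assume "v \<in> (\<lambda>(k, x). x + scale k b) ` (UNIV \<times> local.span B)"
      then obtain k x where "x \<in> local.span B" "v = x + scale k b"
        by auto
      then show "v \<in> local.span (insert b B)"
        unfolding span_breakdown_eq by (intro exI[of _ k]) simp
    qed
  qed
  from bij_betw_same_card[OF this] show ?thesis
    by (simp add: card_cartesian_product)
qed

lemma card_span_independent:
  assumes "finite B" "local.independent B"
  shows "card (local.span B) = CARD('a) ^ card B"
  using assms
proof (induction B rule: finite_induct)
  case (insert b B)
  then show ?case
    by (simp add: independent_insert card_span_insert)
qed simp

lemma card_subspace:
  assumes "local.subspace S"
  shows "card S = CARD('a) ^ local.dim S"
proof -
  obtain B where "finite B" "local.independent B" "local.span B = S" "card B = local.dim S"
    using basis_subspace_exists[OF assms] .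
  then show ?thesis
    using card_span_independent[of B] by simp
qed

lemma card_field_ge_2: "CARD('a) \<ge> 2"
proof -
  have "card {0, 1 :: 'a} \<le> CARD('a)"
    by (intro card_mono) auto
  then show ?thesis by simp
qed

lemma finite_UNIV_space: "finite (UNIV :: 'b set)"
  using card_subspace[of UNIV] by (intro card_ge_0_finite) (simp add: zero_less_card_finite)

lemma finite_vectors [simp]: "finite (S :: 'b set)"
  by (rule finite_subset[OF subset_UNIV finite_UNIV_space])

lemma finite_families [simp]: "finite (\<S> :: 'b set set)"
  by (rule finite_subset[OF _ finite_Pow_iff[THEN iffD2, OF finite_UNIV_space]]) simp

lemma dim_span_insert:
  assumes "local.subspace X" "v \<notin> X"
  shows "local.dim (local.span (insert v X)) = Suc (local.dim X)"
proof -
  have "local.span X = X"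
    using assms(1) by simp
  then show ?thesis
    unfolding dim_span dim_insert using assms(2) by (simp only: if_False Suc_eq_plus1)
qed

text \<open>A vector v of Y outside X lies in exactly one cover of X, the span of X and v. So the
  sets Z - X partition Y - X into parts of equal size.\<close>

lemma card_covers_within:
  assumes X: "local.subspace X" and Y: "local.subspace Y" and "X \<subseteq> Y"
  shows "card {Z. local.subspace Z \<and> X \<subseteq> Z \<and> Z \<subseteq> Y \<and> local.dim Z = Suc (local.dim X)}
    = q_int CARD('a) (local.dim Y - local.dim X)"
proof -
  define q where "q = CARD('a)"
  define k where "k = local.dim X"
  define j where "j = local.dim Y - k"
  define C where "C = {Z. local.subspace Z \<and> X \<subseteq> Z \<and> Z \<subseteq> Y \<and> local.dim Z = Suc k}"
  have q: "q \<ge> 2"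
    unfolding q_def by (rule card_field_ge_2)
  have "local.dim Y = k + j"
    using dim_subset[OF \<open>X \<subseteq> Y\<close>] by (simp add: j_def k_def)
  have generated: "Z = local.span (insert v X)" if "Z \<in> C" "v \<in> Z - X" for Z v
  proof -
    have "local.span (insert v X) \<subseteq> Z"
      using that by (intro span_minimal) (auto simp: C_def)
    moreover have "local.dim Z \<le> local.dim (local.span (insert v X))"
      using that dim_span_insert[OF X, of v] by (simp add: C_def k_def)
    ultimately show ?thesis
      using that subspace_dim_equal[of "local.span (insert v X)" Z] by (simp add: C_def)
  qed
  have union: "(\<Union>Z\<in>C. Z - X) = Y - X"
  proof (intro equalityI subsetI)
    fix v assume v: "v \<in> Y - X"
    have "local.span (insert v X) \<subseteq> Y"
      using v Y \<open>X \<subseteq> Y\<close> by (intro span_minimal) auto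
    moreover have "insert v X \<subseteq> local.span (insert v X)"
      by (rule span_superset)
    ultimately have "local.span (insert v X) \<in> C" "v \<in> local.span (insert v X)"
      using v dim_span_insert[OF X, of v] by (auto simp: C_def k_def)
    then show "v \<in> (\<Union>Z\<in>C. Z - X)"
      using v by blast
  qed (auto simp: C_def)
  have "card (\<Union>Z\<in>C. Z - X) = (\<Sum>Z\<in>C. card (Z - X))"
  proof (rule card_UN_disjoint)
    show "\<forall>Z\<in>C. \<forall>Z'\<in>C. Z \<noteq> Z' \<longrightarrow> (Z - X) \<inter> (Z' - X) = {}"
      using generated by blast
  qed auto
  also have "\<dots> = (\<Sum>Z\<in>C. q ^ Suc k - q ^ k)"
    using X by (intro sum.cong) (auto simp: C_def card_Diff_subset card_subspace q_def k_def)
  finally have "q ^ (k + j) - q ^ k = card C * (q ^ Suc k - q ^ k)"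
    using union \<open>X \<subseteq> Y\<close> X Y \<open>local.dim Y = k + j\<close>
    by (simp add: card_Diff_subset card_subspace flip: q_def k_def)
  then have "q ^ k * (q ^ j - 1) = q ^ k * (card C * (q - 1))"
    by (simp add: power_add algebra_simps)
  then have "card C * (q - 1) = q ^ j - 1"
    using q by simp
  also have "\<dots> = q_int q j * (q - 1)"
    using q_int_Suc[of q j] q_int_Suc'[of q j] by (simp add: algebra_simps)
  finally show ?thesis
    using q by (simp add: C_def j_def k_def q_def)
qed

lemma card_subspaces_dim_0:
  assumes "local.subspace Y"
  shows "card {Z. local.subspace Z \<and> Z \<subseteq> Y \<and> local.dim Z = 0} = 1"
proof -
  have "{Z. local.subspace Z \<and> Z \<subseteq> Y \<and> local.dim Z = 0} = {{0}}"
    using assms subspace_0 by auto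
  then show ?thesis by simp
qed

text \<open>Applying the formula by induction to the proper subspaces of \<open>Y\<close>, double counting of flags
  yields all Gaussian numbers of \<open>Y\<close> up to codimension 1.\<close>

lemma card_hyperplanes:
  assumes "local.subspace Y"
  shows "card {Z. local.subspace Z \<and> Z \<subseteq> Y \<and> Suc (local.dim Z) = local.dim Y}
    = q_int CARD('a) (local.dim Y)"
  using assms
proof (induction "local.dim Y" arbitrary: Y rule: less_induct)
  case less
  define q where "q = CARD('a)"
  define d where "d = local.dim Y"
  define S where "S j = {Z. local.subspace Z \<and> Z \<subseteq> Y \<and> local.dim Z = j}" for j
  have step: "card (S j) * q_int q (d - j) = card (S (Suc j)) * q_int q (Suc j)" if "Suc j < d" for j
  proof -
    have "(\<Sum>X\<in>S j. card {Z\<in>S (Suc j). X \<subseteq> Z}) = (\<Sum>X\<in>S j. q_int q (d - j))"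
    proof (rule sum.cong)
      fix X assume X: "X \<in> S j"
      then have "{Z\<in>S (Suc j). X \<subseteq> Z}
          = {Z. local.subspace Z \<and> X \<subseteq> Z \<and> Z \<subseteq> Y \<and> local.dim Z = Suc (local.dim X)}"
        by (auto simp: S_def)
      then show "card {Z\<in>S (Suc j). X \<subseteq> Z} = q_int q (d - j)"
        using card_covers_within[of X Y] X less.prems by (simp add: S_def q_def d_def)
    qed simp
    moreover have "(\<Sum>X\<in>S j. card {Z\<in>S (Suc j). X \<subseteq> Z}) = (\<Sum>Z\<in>S (Suc j). q_int q (Suc j))"
    proof (rule sum_multicount_gen)
      show "\<forall>Z\<in>S (Suc j). card {X \<in> S j. X \<subseteq> Z} = q_int q (Suc j)"
      proof
        fix Z assume Z: "Z \<in> S (Suc j)"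
        then have "{X \<in> S j. X \<subseteq> Z}
            = {X. local.subspace X \<and> X \<subseteq> Z \<and> Suc (local.dim X) = local.dim Z}"
          by (auto simp: S_def)
        then show "card {X \<in> S j. X \<subseteq> Z} = q_int q (Suc j)"
          using less.hyps[of Z] Z that by (simp add: S_def q_def d_def)
      qed
    qed auto
    ultimately show ?thesis by simp
  qed
  show ?case
  proof (cases d)
    case 0
    then show ?thesis
      unfolding d_def[symmetric] by simp
  next
    case (Suc e)
    have "card (S j) * (\<Prod>i<j. q_int q (Suc i)) = (\<Prod>i<j. q_int q (d - i))" if "j < d" for j
      using that
    proof (induction j)
      case 0
      then show ?case
        using card_subspaces_dim_0[OF less.prems] by (simp add: S_def)
    next
      case (Suc j)
      have "card (S (Suc j)) * (\<Prod>i<Suc j. q_int q (Suc i))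
          = (card (S (Suc j)) * q_int q (Suc j)) * (\<Prod>i<j. q_int q (Suc i))"
        by (simp add: mult_ac)
      also have "\<dots> = (card (S j) * (\<Prod>i<j. q_int q (Suc i))) * q_int q (d - j)"
        unfolding step[OF Suc.prems, symmetric] by (simp only: mult_ac)
      finally show ?case
        using Suc by simp
    qed
    then have "card (S e) * (\<Prod>i<e. q_int q (Suc i)) = (\<Prod>i<e. q_int q (d - i))"
      using Suc by simp
    \<comment> \<open>With d = e + 1 the factors are [2], ..., [d]; inserting [1] = 1 and splitting
      off [d] leaves the product on the left, which cancels.\<close>
    also have "\<dots> = (\<Prod>i<e. q_int q (Suc (Suc i)))"
      by (subst prod.nat_diff_reindex[symmetric]) (auto intro!: prod.cong simp: Suc)
    also have "\<dots> = (\<Prod>i<Suc e. q_int q (Suc i))"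
      by (subst prod.lessThan_Suc_shift) (simp add: q_int_Suc[of q 0])
    also have "\<dots> = q_int q d * (\<Prod>i<e. q_int q (Suc i))"
      by (simp add: Suc)
    finally have "card (S e) = q_int q d"
      by (simp add: q_int_Suc)
    then show ?thesis
      using Suc by (simp add: S_def d_def q_def)
  qed
qed

text \<open>The only candidates are X + X' above and the intersection of X and X' below. By the
  dimension formula one of them has the right dimension exactly when the other has.\<close>

lemma common_covers_subspaces:
  assumes X: "local.subspace X" and X': "local.subspace X'" and "X \<noteq> X'"
    and dim: "local.dim X = local.dim X'"
  shows "card {Z \<in> subspaces. local.dim Z = Suc (local.dim X) \<and> X \<subseteq> Z \<and> X' \<subseteq> Z}
      = card {Z \<in> subspaces. Suc (local.dim Z) = local.dim X \<and> Z \<subseteq> X \<and> Z \<subseteq> X'}" (is "card ?U = card ?L")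
    and "card {Z \<in> subspaces. local.dim Z = Suc (local.dim X) \<and> X \<subseteq> Z \<and> X' \<subseteq> Z} \<le> 1"
proof -
  define S where "S = {x + y |x y. x \<in> X \<and> y \<in> X'}"
  have S: "local.subspace S" and I: "local.subspace (X \<inter> X')"
    unfolding S_def using X X' by (simp_all add: subspace_sums subspace_inter)
  have sum: "local.dim S + local.dim (X \<inter> X') = 2 * local.dim X"
    using dim_sums_Int[OF X X'] dim by (simp add: S_def)
  have "x \<in> S" if "x \<in> X" for x
    using that subspace_0[OF X'] by (force simp: S_def)
  moreover have "x \<in> S" if "x \<in> X'" for x
    using that subspace_0[OF X] by (force simp: S_def)
  ultimately have sub: "X \<subseteq> S" "X' \<subseteq> S"
    by auto
  have "Suc (local.dim X) \<le> local.dim S"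
  proof (rule ccontr)
    assume "\<not> ?thesis"
    then have "X = S" "X' = S"
      using subspace_dim_equal[OF X S] subspace_dim_equal[OF X' S] sub dim by auto
    then show False
      using \<open>X \<noteq> X'\<close> by simp
  qed
  then have S_dim: "Suc (local.dim X) \<le> local.dim S" "Suc (local.dim (X \<inter> X')) \<le> local.dim X"
    using sum by auto
  have U: "?U = (if local.dim S = Suc (local.dim X) then {S} else {})"
  proof -
    have "Z = S" if "Z \<in> ?U" for Z
    proof -
      have "S \<subseteq> Z"
        using that by (auto simp: S_def subspaces_def intro: subspace_add)
      then show ?thesis
        using subspace_dim_equal[OF S, of Z] that S_dim by (simp add: subspaces_def)
    qed
    moreover have "S \<in> ?U" if "local.dim S = Suc (local.dim X)"
      using that S sub by (simp add: subspaces_def)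
    ultimately show ?thesis
      by auto
  qed
  have L: "?L = (if Suc (local.dim (X \<inter> X')) = local.dim X then {X \<inter> X'} else {})"
  proof -
    have "Z = X \<inter> X'" if "Z \<in> ?L" for Z
      using subspace_dim_equal[of Z "X \<inter> X'"] that I S_dim by (auto simp: subspaces_def)
    moreover have "X \<inter> X' \<in> ?L" if "Suc (local.dim (X \<inter> X')) = local.dim X"
      using that I by (simp add: subspaces_def)
    ultimately show ?thesis
      by auto
  qed
  show "card ?U = card ?L" "card ?U \<le> 1"
    unfolding U L using sum by auto
qed

lemma q_regular_poset_subspaces:
  assumes "local.dim UNIV = n"
  shows "q_regular_poset subspaces (\<subseteq>) local.dim n CARD('a)"
proof
  show "2 \<le> CARD('a)"
    by (rule card_field_ge_2)
  show "finite subspaces"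
    by simp
  show "card {X \<in> subspaces. local.dim X = 0} = 1"
    using card_subspaces_dim_0[of UNIV] by (simp add: subspaces_def)
  have "{X \<in> subspaces. local.dim X = n} = {UNIV}"
  proof (intro equalityI subsetI)
    fix X assume "X \<in> {X \<in> subspaces. local.dim X = n}"
    then show "X \<in> {UNIV}"
      using assms subspace_dim_equal[of X UNIV] by (simp add: subspaces_def del: dim_UNIV)
  qed (use assms in \<open>simp add: subspaces_def del: dim_UNIV\<close>)
  then show "card {X \<in> subspaces. local.dim X = n} = 1"
    by simp
next
  fix X assume X: "X \<in> subspaces"
  then show "local.dim X \<le> n"
    using assms dim_subset[of X UNIV] by simp
  show "card {Y \<in> subspaces. local.dim Y = Suc (local.dim X) \<and> X \<subseteq> Y} = q_int CARD('a) (n - local.dim X)"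
    using card_covers_within[of X UNIV] X assms
    by (simp add: subspaces_def conj_commute conj_left_commute del: dim_UNIV)
  show "card {Y \<in> subspaces. Suc (local.dim Y) = local.dim X \<and> Y \<subseteq> X} = q_int CARD('a) (local.dim X)"
    using card_hyperplanes[of X] X by (simp add: subspaces_def conj_commute conj_left_commute)
next
  fix X X' assume "X \<in> subspaces" "X' \<in> subspaces" "X \<noteq> X'" "local.dim X = local.dim X'"
  then show "card {Z \<in> subspaces. local.dim Z = Suc (local.dim X) \<and> X \<subseteq> Z \<and> X' \<subseteq> Z}
      = card {Z \<in> subspaces. Suc (local.dim Z) = local.dim X \<and> Z \<subseteq> X \<and> Z \<subseteq> X'}"
    "card {Z \<in> subspaces. local.dim Z = Suc (local.dim X) \<and> X \<subseteq> Z \<and> X' \<subseteq> Z} \<le> 1"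
    using common_covers_subspaces[of X X'] by (simp_all add: subspaces_def)
next
  fix X Y assume "X \<in> subspaces" "Y \<in> subspaces" "X \<subseteq> Y"
  then show "local.dim X \<le> local.dim Y"
    by (simp add: dim_subset)
next
  fix X Y assume "X \<in> subspaces" "Y \<in> subspaces" "X \<subseteq> Y" "local.dim X = local.dim Y"
  then show "X = Y"
    by (simp add: subspace_dim_equal subspaces_def)
next
  fix X Y Z :: "'b set" assume "X \<subseteq> Y" "Y \<subseteq> Z"
  then show "X \<subseteq> Z"
    by (rule order_trans)
qed

end

section \<open>Transfer to antichains of subspaces\<close>

theorem theorem5:
  fixes scale :: "'a::{field,finite} \<Rightarrow> 'v::ab_group_add \<Rightarrow> 'v"
    and q n :: nat
    and \<F> :: "'v set set"
  assumes "vector_space scale"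
    and "q = CARD('a)"
    and "vector_space.dim scale (UNIV :: 'v set) = n"
    and "n > 1"
    and "\<F> \<subseteq> vector_space.subspaces scale"
    and "antichain \<F>"
  shows "(real (card \<F>) \<le> gauss_binomial q n (n div 2) \<and>
          (real (card \<F>) = gauss_binomial q n (n div 2) \<longleftrightarrow>
             \<F> = vector_space.k_subspaces scale (n div 2) \<or>
             \<F> = vector_space.k_subspaces scale ((n + 1) div 2))) \<and>
         (\<not> \<F> \<subseteq> vector_space.k_subspaces scale (n div 2) \<and>
          \<not> \<F> \<subseteq> vector_space.k_subspaces scale ((n + 1) div 2) \<longrightarrow>
            real (card \<F>)
              \<le> gauss_binomial q n (n div 2) - real q * gauss_binomial q (n div 2) 1 \<and>
            (real (card \<F>)
              = gauss_binomial q n (n div 2) - real q * gauss_binomial q (n div 2) 1 \<longleftrightarrow>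
               (\<exists>U \<in> vector_space.k_subspaces scale ((n + 1) div 2 - 1).
                  \<F> = vector_space.family_A scale n U) \<or>
               (\<exists>W \<in> vector_space.k_subspaces scale (n div 2 + 1).
                  \<F> = vector_space.family_B scale n W)))"
proof -
  interpret V: vector_space scale
    by fact
  obtain B where B: "V.independent B" "UNIV \<subseteq> V.span B" "card B = n"
    using V.basis_exists[of UNIV] assms(3) by metis
  \<comment> \<open>An infinite basis would have \<open>card\<close> 0, which n > 1 rules
    out.\<close>
  have "finite B"
    using B(3) \<open>n > 1\<close> by (intro card_ge_0_finite) simp
  interpret finite_field_space scale B
    using B \<open>finite B\<close> by unfold_locales auto
  interpret L: q_regular_poset V.subspaces "(\<subseteq>)" V.dim n q
    unfolding \<open>q = CARD('a)\<close> by (rule q_regular_poset_subspaces) fact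
  define m where "m = n div 2"
  have ceil: "(n + 1) div 2 = n - m"
    by (simp add: m_def)
  have level: "V.k_subspaces k = L.level k" for k
    unfolding V.k_subspaces_def L.level_def unfolding V.subspaces_def by simp
  have A: "V.family_A n U = {X \<in> L.level (n - m). \<not> U \<subseteq> X} \<union> {U}" for U
    unfolding V.family_A_def level ceil by blast
  have B: "V.family_B n W = {X \<in> L.level m. \<not> X \<subseteq> W} \<union> {W}" for W
    unfolding V.family_B_def level m_def by blast
  have anti: "L.incomparable \<F>"
    using assms(5,6) by (auto simp: L.incomparable_def antichain_def)
  have N: "gauss_binomial q n m = card (L.level m)"
    by (rule L.card_level_gauss_binomial[symmetric])
  have q1: "gauss_binomial q m 1 = real (q_int q m)"
    using power_diff_1_eq[of "real q" m] L.q_ge_2 by (simp add: gauss_binomial_def q_int_def)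
  \<comment> \<open>A positive gap makes the bound for antichains outside both middle levels strict,
    which yields the equality case of the first claim.\<close>
  have gap: "q * q_int q m > 0"
    using L.q_times_q_int_ge_2[of m] \<open>n > 1\<close> unfolding m_def by linarith
  note bound = L.two_sided_bound[OF anti \<open>n > 1\<close> m_def]
  have middle: "card (L.level (n - m)) = card (L.level m)"
    by (rule L.card_level_middle[OF m_def])
  have "card \<F> \<le> card (L.level m) \<and>
      (card \<F> = card (L.level m) \<longleftrightarrow> \<F> = L.level m \<or> \<F> = L.level (n - m))"
  proof (cases "\<F> \<subseteq> L.level m \<or> \<F> \<subseteq> L.level (n - m)")
    case True
    then show ?thesis
      using middle card_mono[of "L.level m" \<F>] card_mono[of "L.level (n - m)" \<F>]
        card_subset_eq[of "L.level m" \<F>] card_subset_eq[of "L.level (n - m)" \<F>] by auto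
  next
    case False
    then have "card \<F> + q * q_int q m \<le> card (L.level m)"
      using bound by blast
    then have "card \<F> < card (L.level m)"
      using gap by linarith
    then show ?thesis
      using False by auto
  qed
  moreover have "card \<F> + q * q_int q m \<le> card (L.level m) \<and>
      (card \<F> + q * q_int q m = card (L.level m) \<longleftrightarrow>
        (\<exists>U\<in>L.level (n - m - 1). \<F> = V.family_A n U) \<or> (\<exists>W\<in>L.level (m + 1). \<F> = V.family_B n W))"
    if "\<not> \<F> \<subseteq> L.level m \<and> \<not> \<F> \<subseteq> L.level (n - m)"
  proof (intro conjI iffI)
    note bound' = bound[OF that[THEN conjunct1] that[THEN conjunct2], folded A B]
    show "card \<F> + q * q_int q m \<le> card (L.level m)"
      by (rule bound'[THEN conjunct1])
    show "(\<exists>U\<in>L.level (n - m - 1). \<F> = V.family_A n U) \<or> (\<exists>W\<in>L.level (m + 1). \<F> = V.family_B n W)"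
      if "card \<F> + q * q_int q m = card (L.level m)"
      by (rule bound'[THEN conjunct2, THEN mp, OF that])
    show "card \<F> + q * q_int q m = card (L.level m)"
      if "(\<exists>U\<in>L.level (n - m - 1). \<F> = V.family_A n U) \<or> (\<exists>W\<in>L.level (m + 1). \<F> = V.family_B n W)"
      using that
    proof (elim disjE bexE)
      fix U assume "U \<in> L.level (n - m - 1)" "\<F> = V.family_A n U"
      then show ?thesis
        using L.card_star_family[OF \<open>n > 1\<close> m_def] by (simp only: A)
    next
      fix W assume "W \<in> L.level (m + 1)" "\<F> = V.family_B n W"
      then show ?thesis
        using L.card_costar_family[OF \<open>n > 1\<close> m_def] by (simp only: B)
    qed
  qed
  \<comment> \<open>The real subtraction of the statement is matched with the additive form over the
    naturals.\<close>
  moreover have "real (card \<F>) \<le> real (card (L.level m)) - real q * real (q_int q m)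
      \<longleftrightarrow> card \<F> + q * q_int q m \<le> card (L.level m)"
    by (simp flip: of_nat_mult of_nat_add add: le_diff_eq)
  moreover have "real (card \<F>) = real (card (L.level m)) - real q * real (q_int q m)
      \<longleftrightarrow> card \<F> + q * q_int q m = card (L.level m)"
    by (simp flip: of_nat_mult of_nat_add add: eq_diff_eq)
  ultimately show ?thesis
    unfolding level ceil unfolding m_def[symmetric] N q1 of_nat_le_iff of_nat_eq_iff by simp
qed

end
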